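(* Let $\kappa\in\{1/2,3/2\}$ and let $\mathbf g=(g_1,\dots,g_r):\mathbb H\to\mathbb C^r$ be a vector-valued cusp form of weight $\kappa$ for $\mathsf{Mp}_2(\mathbb Z)$ with unitary multiplier system $\varrho$, where $\varrho(T)=\mathrm{diag}(e^{2\pi i\alpha_1},\dots,e^{2\pi i\alpha_r})$ has finite order, $\alpha_k\in\mathbb Q\cap[0,1)$. Then the vector of Eichler integrals $\mathsf{EI}[\mathbf g]$ is a vector-valued holomorphic quantum modular form for $\mathsf{SL}_2(\mathbb Z)$ of weight $\eta=2-\kappa$ and multiplier system $\varrho$; that is, for every $\gamma=\begin{pmatrix}a&b\\c&d\end{pmatrix}\in\mathsf{SL}_2(\mathbb Z)$ the function $$(c\tau+d)^{-\eta}\,\varrho(\gamma)^{-1}\,\mathsf{EI}[\mathbf g]\left(\tfrac{a\tau+b}{c\tau+d}\right)-\mathsf{EI}[\mathbf g](\tau),\qquad\tau\in\mathbb H,$$ extends holomorphically to $\mathbb C_\gamma=\{\tau\in\mathbb C:c\tau+d\in\mathbb C\smallsetminus\mathbb R_{\le0}\}$.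
   Context: $\mathbb H$ is the upper half-plane, $q=e^{2\pi i\tau}$, $T=\begin{pmatrix}1&1\\0&1\end{pmatrix}$; powers of $c\tau+d$ use the principal branch. A multiplier system of weight $\kappa$ is a map $\varrho:\mathsf{SL}_2(\mathbb Z)\to\mathsf{GL}_r(\mathbb C)$ such that $\mathbf j(\tau;\gamma)=(c\tau+d)^\kappa\varrho(\gamma)$ satisfies $\mathbf j(\tau;\gamma\gamma')=\mathbf j(\gamma'\tau;\gamma)\,\mathbf j(\tau;\gamma')$ (equivalently, it comes from a representation of the metaplectic double cover $\mathsf{Mp}_2(\mathbb Z)$). That $\mathbf g$ is a cusp form of weight $\kappa$ and multiplier $\varrho$ means that $\mathbf g$ is holomorphic, $\mathbf g(\gamma\tau)=(c\tau+d)^\kappa\varrho(\gamma)\mathbf g(\tau)$ for all $\gamma$, and $$g_k(\tau)=\sum_{\lambda\in\alpha_k+\mathbb Z_{\ge0},\ \lambda>0}a_k(\lambda)\,q^\lambda,\qquad a_k(\lambda)=O(\lambda^{\kappa/2}).$$ The vector of Eichler integrals $\mathsf{EI}[\mathbf g]=(\mathsf{EI}[g_k])_{k=1}^r$ is defined by $\mathsf{EI}[g_k](\tau)=\sum_\lambda\lambda^{1-\kappa}a_k(\lambda)\,q^\lambda$. *)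

theory Defs
  imports "HOL-Complex_Analysis.Complex_Analysis"
begin

definition upper_half_plane :: "complex set"
  where "upper_half_plane = {\<tau>. Im \<tau> > 0}"

definition SL2Z :: "(int^2^2) set"
  where "SL2Z = {\<gamma>. det \<gamma> = 1}"

definition T_mat :: "int^2^2"
  where "T_mat = vector [vector [1, 1], vector [0, 1]]"

definition SL2Z_act :: "int^2^2 \<Rightarrow> complex \<Rightarrow> complex"
  where "SL2Z_act \<gamma> =
    moebius (of_int (\<gamma>$1$1)) (of_int (\<gamma>$1$2)) (of_int (\<gamma>$2$1)) (of_int (\<gamma>$2$2))"

definition cocycle_denom :: "int^2^2 \<Rightarrow> complex \<Rightarrow> complex"
  where "cocycle_denom \<gamma> \<tau> = of_int (\<gamma>$2$1) * \<tau> + of_int (\<gamma>$2$2)"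

text \<open>The library's complex power is the principal branch, with arguments in the
  interval from \<open>-pi\<close> (excluded) to \<open>pi\<close> (included); this convention matters for
  \<open>c = 0\<close>, \<open>d = -1\<close>.\<close>

definition aut_factor :: "real \<Rightarrow> (int^2^2 \<Rightarrow> complex^'r^'r) \<Rightarrow> complex \<Rightarrow> int^2^2 \<Rightarrow> complex^'r^'r"
  where "aut_factor \<kappa> \<rho> \<tau> \<gamma> = mat (cocycle_denom \<gamma> \<tau> powr of_real \<kappa>) ** \<rho> \<gamma>"

definition multiplier_system :: "real \<Rightarrow> (int^2^2 \<Rightarrow> complex^'r^'r) \<Rightarrow> bool"
  where "multiplier_system \<kappa> \<rho> \<longleftrightarrow>
    (\<forall>\<gamma>\<in>SL2Z. invertible (\<rho> \<gamma>)) \<and>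
    (\<forall>\<gamma>\<in>SL2Z. \<forall>\<gamma>'\<in>SL2Z. \<forall>\<tau>\<in>upper_half_plane.
       aut_factor \<kappa> \<rho> \<tau> (\<gamma> ** \<gamma>') =
       aut_factor \<kappa> \<rho> (SL2Z_act \<gamma>' \<tau>) \<gamma> ** aut_factor \<kappa> \<rho> \<tau> \<gamma>')"

definition unitary_matrix :: "complex^'r^'r \<Rightarrow> bool"
  where "unitary_matrix U \<longleftrightarrow>
    map_matrix cnj (transpose U) ** U = mat 1 \<and> U ** map_matrix cnj (transpose U) = mat 1"

definition vec_holomorphic_on :: "(complex \<Rightarrow> complex^'r) \<Rightarrow> complex set \<Rightarrow> bool"
  where "vec_holomorphic_on f S \<longleftrightarrow> (\<forall>k. (\<lambda>\<tau>. f \<tau> $ k) holomorphic_on S)"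

definition q_exponents :: "real \<Rightarrow> real set"
  where "q_exponents \<alpha> = {l. (\<exists>n::nat. l = \<alpha> + real n) \<and> l > 0}"

definition q_power :: "complex \<Rightarrow> real \<Rightarrow> complex"
  where "q_power \<tau> l = exp (2 * of_real pi * \<i> * of_real l * \<tau>)"

text \<open>Only the values of \<open>a k\<close> on \<open>q_exponents (\<alpha> k)\<close> matter. Since that set is bounded
  away from 0 and has no finite accumulation point, a bound with one constant on the whole set
  is the same as a bound for large exponents.\<close>

definition cusp_expansion ::
    "real \<Rightarrow> ('r \<Rightarrow> real) \<Rightarrow> (complex \<Rightarrow> complex^'r) \<Rightarrow> ('r \<Rightarrow> real \<Rightarrow> complex) \<Rightarrow> bool"
  where "cusp_expansion \<kappa> \<alpha> g a \<longleftrightarrow>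
    (\<forall>k. (\<forall>\<tau>\<in>upper_half_plane.
            ((\<lambda>l. a k l * q_power \<tau> l) has_sum (g \<tau> $ k)) (q_exponents (\<alpha> k))) \<and>
         (\<exists>C. \<forall>l\<in>q_exponents (\<alpha> k). norm (a k l) \<le> C * l powr (\<kappa> / 2)))"

definition cusp_form ::
    "real \<Rightarrow> (int^2^2 \<Rightarrow> complex^'r^'r) \<Rightarrow> ('r \<Rightarrow> real) \<Rightarrow> (complex \<Rightarrow> complex^'r) \<Rightarrow> bool"
  where "cusp_form \<kappa> \<rho> \<alpha> g \<longleftrightarrow>
    vec_holomorphic_on g upper_half_plane \<and>
    (\<forall>\<gamma>\<in>SL2Z. \<forall>\<tau>\<in>upper_half_plane. g (SL2Z_act \<gamma> \<tau>) = aut_factor \<kappa> \<rho> \<tau> \<gamma> *v g \<tau>) \<and>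
    (\<exists>a. cusp_expansion \<kappa> \<alpha> g a)"

definition eichler_integral ::
    "real \<Rightarrow> ('r \<Rightarrow> real) \<Rightarrow> ('r \<Rightarrow> real \<Rightarrow> complex) \<Rightarrow> complex \<Rightarrow> complex^'r"
  where "eichler_integral \<kappa> \<alpha> a \<tau> =
    (\<chi> k. \<Sum>\<^sub>\<infinity>l\<in>q_exponents (\<alpha> k). of_real (l powr (1 - \<kappa>)) * a k l * q_power \<tau> l)"

definition cut_plane :: "int^2^2 \<Rightarrow> complex set"
  where "cut_plane \<gamma> = {\<tau>. cocycle_denom \<gamma> \<tau> \<notin> \<real>\<^sub>\<le>\<^sub>0}"

text \<open>The cut plane is empty for \<open>c = 0\<close>, \<open>d = -1\<close>, and otherwise contains the upper
  half-plane, so \<open>extends_holomorphically\<close> is vacuous exactly in the former case.\<close>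

definition extends_holomorphically :: "(complex \<Rightarrow> complex^'r) \<Rightarrow> complex set \<Rightarrow> bool"
  where "extends_holomorphically h S \<longleftrightarrow>
    (\<exists>F. vec_holomorphic_on F S \<and> (\<forall>\<tau>\<in>upper_half_plane. F \<tau> = h \<tau>))"

definition modularity_defect ::
    "real \<Rightarrow> (int^2^2 \<Rightarrow> complex^'r^'r) \<Rightarrow> (complex \<Rightarrow> complex^'r) \<Rightarrow> int^2^2 \<Rightarrow> complex \<Rightarrow> complex^'r"
  where "modularity_defect \<eta> \<rho> f \<gamma> \<tau> =
    (cocycle_denom \<gamma> \<tau> powr (- of_real \<eta>)) *s (matrix_inv (\<rho> \<gamma>) *v f (SL2Z_act \<gamma> \<tau>)) - f \<tau>"

definition holomorphic_quantum_modular_form ::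
    "real \<Rightarrow> (int^2^2 \<Rightarrow> complex^'r^'r) \<Rightarrow> (complex \<Rightarrow> complex^'r) \<Rightarrow> bool"
  where "holomorphic_quantum_modular_form \<eta> \<rho> f \<longleftrightarrow>
    vec_holomorphic_on f upper_half_plane \<and>
    (\<forall>\<gamma>\<in>SL2Z. extends_holomorphically (modularity_defect \<eta> \<rho> f \<gamma>) (cut_plane \<gamma>))"

end

theory Submission
  imports Defs "HOL-Probability.Distributions"
begin

text \<open>
Write \<open>N = 4 - 2 \<kappa>\<close>, so \<open>N = 3\<close> for weight \<open>1/2\<close> and \<open>N = 1\<close> for weight \<open>3/2\<close>. Formally, up to a
constant, the Eichler integral of \<open>g\<close> at \<open>\<tau>\<close> is the integral of the form
\<open>g(w) (w - \<tau>)^(-N/2) dw\<close> from \<open>\<tau>\<close> to the cusp at infinity. This form transforms under \<open>\<gamma>\<close> with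
weight \<open>N/2 = 2 - \<kappa>\<close> in \<open>\<tau>\<close>. Hence the Eichler integral at \<open>\<gamma> \<tau>\<close> becomes the integral of the
same form from \<open>\<tau>\<close> to the cusp \<open>-d/c\<close>, and the modularity defect is an integral between the two
cusps \<open>-d/c\<close> and infinity. On a fixed path between the cusps \<open>\<tau>\<close> enters only through the kernel,
so this integral is holomorphic in \<open>\<tau>\<close> wherever the kernel stays on its branch.

Two points need care: the kernel is double-valued, and for \<open>N = 3\<close> it is not integrable at
\<open>\<tau>\<close>. Both are resolved by the coordinate \<open>z\<close> with \<open>w = \<tau> + z^2\<close>, in which the form becomes
\<open>2 g(\<tau> + z^2) z^(1 - N) dz\<close>, an even meromorphic form without residue. It has a unique odd
primitive (\<open>odd_primitive\<close>), and this primitive is the regularised integral starting at \<open>\<tau>\<close>. Its limit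
towards infinity is a constant times the Eichler integral, by Gaussian integrals of the
terms of the expansion (\<open>q_series_half_primitive\<close>, \<open>ex_odd_primitive\<close>), and by the decay of \<open>g\<close> it may be taken along
any vertical line (\<open>odd_primitive_tendsto\<close>). Uniqueness of the odd primitive yields its
transformation law under \<open>\<gamma>\<close> without constants of integration
(\<open>odd_primitive_transform\<close>).

For \<open>c \<noteq> 0\<close> the path is the vertical line above \<open>-d/c\<close>. For \<open>\<tau>\<close> on the side
\<open>Re (c \<tau> + d) > 0\<close> the fundamental theorem of calculus identifies the path integral with the
defect (\<open>period_integral\<close>). That integral is holomorphic also in the lower half-plane
(\<open>kernel_integral_holomorphic\<close>), and gluing it with the defect on the upper half-plane gives
the extension to the cut plane (\<open>defect_extends\<close>). For \<open>c = 0\<close> the defect vanishes by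
periodicity, or the cut plane is empty.
\<close>

section \<open>Expansions at the cusp\<close>

definition q_series :: "real \<Rightarrow> (nat \<Rightarrow> complex) \<Rightarrow> complex \<Rightarrow> complex"
  where "q_series \<alpha> A \<tau> = (\<Sum>n. A n * q_power \<tau> (\<alpha> + real n))"

text \<open>
With \<open>\<tau> = x + i y\<close> the last clause is absolute convergence of \<open>q_series\<close> on the whole upper
half-plane. Unlike a bound of fixed order on the coefficients, this condition is stable under
multiplication of the coefficients by powers of the exponent. The clause on
\<open>A 0\<close> makes the constant term vanish, so that the exponents that occur are bounded away
from 0.
\<close>
definition cuspidal_coeffs :: "real \<Rightarrow> (nat \<Rightarrow> complex) \<Rightarrow> bool"
  where "cuspidal_coeffs \<alpha> A \<longleftrightarrow> 0 \<le> \<alpha> \<and> (\<alpha> = 0 \<longrightarrow> A 0 = 0) \<and>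
    (\<forall>y>0. summable (\<lambda>n. norm (A n) * exp (- 2 * pi * (\<alpha> + real n) * y)))"

lemma norm_q_power: "norm (q_power \<tau> l) = exp (- 2 * pi * l * Im \<tau>)"
  unfolding q_power_def norm_exp_eq_Re by simp

lemma has_field_derivative_q_power [derivative_intros]:
  "((\<lambda>\<tau>. q_power \<tau> l) has_field_derivative (2 * of_real pi * \<i> * of_real l) * q_power \<tau> l) (at \<tau> within S)"
  unfolding q_power_def by (auto intro!: derivative_eq_intros)

lemma q_power_add: "q_power (\<tau> + w) l = q_power \<tau> l * q_power w l"
  unfolding q_power_def by (simp add: exp_add [symmetric] algebra_simps)

lemma cuspidal_coeffs_summable:
  "cuspidal_coeffs \<alpha> A \<Longrightarrow> y > 0 \<Longrightarrow>
     summable (\<lambda>n. norm (A n) * exp (- 2 * pi * (\<alpha> + real n) * y))"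
  unfolding cuspidal_coeffs_def by blast

lemma summable_q_series:
  assumes "cuspidal_coeffs \<alpha> A" "Im \<tau> > 0"
  shows "summable (\<lambda>n. norm (A n * q_power \<tau> (\<alpha> + real n)))"
  using assms unfolding cuspidal_coeffs_def by (simp add: norm_mult norm_q_power)

text \<open>
A factor of linear growth in the exponent costs only half of the exponential decay, because
\<open>x exp (-x) \<le> 1\<close>.
\<close>
lemma cuspidal_coeffs_mult:
  assumes A: "cuspidal_coeffs \<alpha> A" and B: "\<And>n. A n \<noteq> 0 \<Longrightarrow> norm (B n) \<le> C * (1 + (\<alpha> + real n))"
  shows "cuspidal_coeffs \<alpha> (\<lambda>n. B n * A n)"
  unfolding cuspidal_coeffs_def
proof (intro conjI allI impI)
  show "0 \<le> \<alpha>" using A by (simp add: cuspidal_coeffs_def)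
  show "B 0 * A 0 = 0" if "\<alpha> = 0" using A that by (simp add: cuspidal_coeffs_def)
  fix y :: real assume y: "y > 0"
  define D where "D = \<bar>C\<bar> * (1 + 1 / (pi * y))"
  have "summable (\<lambda>n. D * (norm (A n) * exp (- 2 * pi * (\<alpha> + real n) * (y/2))))"
    using y by (intro summable_mult cuspidal_coeffs_summable[OF A]) simp
  then show "summable (\<lambda>n. norm (B n * A n) * exp (- 2 * pi * (\<alpha> + real n) * y))"
  proof (rule summable_comparison_test')
    fix n :: nat
    define l where "l = \<alpha> + real n"
    have l: "l \<ge> 0" using A by (simp add: l_def cuspidal_coeffs_def)
    have e: "exp (- 2 * pi * l * y) = exp (- (pi * l * y)) * exp (- 2 * pi * l * (y/2))"
      by (simp add: exp_add [symmetric] field_simps)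
    have "pi * l * y \<le> exp (pi * l * y)" using exp_ge_add_one_self[of "pi * l * y"] by linarith
    then have a: "l * exp (- (pi * l * y)) \<le> 1 / (pi * y)"
      using y by (simp add: exp_minus field_simps)
    have b: "exp (- (pi * l * y)) \<le> 1" using y l by simp
    have 1: "(1 + l) * exp (- (pi * l * y)) \<le> 1 + 1 / (pi * y)"
      unfolding distrib_right mult_1 by (rule add_mono[OF b a])
    have "norm (B n * A n) \<le> \<bar>C\<bar> * (1 + l) * norm (A n)"
    proof (cases "A n = 0")
      case False
      have "norm (B n) \<le> C * (1 + l)" using B[OF False] by (simp add: l_def)
      also have "\<dots> \<le> \<bar>C\<bar> * (1 + l)" using l by (intro mult_right_mono) auto
      finally show ?thesis by (simp add: norm_mult mult_right_mono)
    qed auto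
    then have "norm (B n * A n) * exp (- 2 * pi * l * y)
       \<le> (\<bar>C\<bar> * (1 + l) * norm (A n)) * exp (- 2 * pi * l * y)"
      by (rule mult_right_mono) auto
    also have "\<dots> = (\<bar>C\<bar> * norm (A n) * exp (- 2 * pi * l * (y/2))) * ((1 + l) * exp (- (pi * l * y)))"
      unfolding e by (simp add: algebra_simps)
    also have "\<dots> \<le> (\<bar>C\<bar> * norm (A n) * exp (- 2 * pi * l * (y/2))) * (1 + 1 / (pi * y))"
      using 1 by (rule mult_left_mono) auto
    also have "\<dots> = D * (norm (A n) * exp (- 2 * pi * l * (y/2)))"
      by (simp add: D_def)
    finally show "norm (norm (B n * A n) * exp (- 2 * pi * (\<alpha> + real n) * y))
      \<le> D * (norm (A n) * exp (- 2 * pi * (\<alpha> + real n) * (y/2)))"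
      by (simp add: l_def)
  qed
qed

lemma cuspidal_coeffs_deriv:
  assumes "cuspidal_coeffs \<alpha> A"
  shows "cuspidal_coeffs \<alpha> (\<lambda>n. (2 * of_real pi * \<i> * of_real (\<alpha> + real n)) * A n)"
proof (rule cuspidal_coeffs_mult[OF assms])
  fix n
  have "0 \<le> \<alpha>" using assms by (simp add: cuspidal_coeffs_def)
  then show "norm (2 * of_real pi * \<i> * of_real (\<alpha> + real n) :: complex) \<le> (2 * pi) * (1 + (\<alpha> + real n))"
    unfolding norm_mult norm_of_real by simp
qed

lemma q_series_has_field_derivative:
  assumes A: "cuspidal_coeffs \<alpha> A" and \<tau>: "Im \<tau> > 0"
  shows "(q_series \<alpha> A has_field_derivative
     q_series \<alpha> (\<lambda>n. (2 * of_real pi * \<i> * of_real (\<alpha> + real n)) * A n) \<tau>) (at \<tau>)"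
proof -
  define \<delta> where "\<delta> = Im \<tau> / 2"
  define S where "S = {w. Im w > \<delta>}"
  have \<delta>: "\<delta> > 0" "\<delta> < Im \<tau>" using \<tau> by (auto simp: \<delta>_def)
  have S: "open S" "convex S" "\<tau> \<in> S"
    using \<delta> unfolding S_def by (auto intro: open_halfspace_Im_gt convex_halfspace_Im_gt)
  let ?A' = "\<lambda>n. (2 * of_real pi * \<i> * of_real (\<alpha> + real n)) * A n"
  let ?f = "\<lambda>n w. A n * q_power w (\<alpha> + real n)"
  let ?f' = "\<lambda>n w. ?A' n * q_power w (\<alpha> + real n)"
  have al: "\<alpha> \<ge> 0" using A by (simp add: cuspidal_coeffs_def)
  have "((\<lambda>w. \<Sum>n. ?f n w) has_field_derivative (\<Sum>n. ?f' n \<tau>)) (at \<tau>)"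
  proof (rule has_field_derivative_series'(2)[where S = S and x0 = \<tau>])
    show "(?f n has_field_derivative ?f' n w) (at w within S)" for n w
      by (auto intro!: derivative_eq_intros)
    show "summable (\<lambda>n. ?f n \<tau>)"
      using summable_q_series[OF A \<tau>] by (rule summable_norm_cancel)
    show "uniformly_convergent_on S (\<lambda>n x. \<Sum>i<n. ?f' i x)"
    proof (rule Weierstrass_m_test')
      show "summable (\<lambda>n. norm (?A' n) * exp (- 2 * pi * (\<alpha> + real n) * \<delta>))"
        using cuspidal_coeffs_deriv[OF A] \<delta> by (simp add: cuspidal_coeffs_def)
      show "norm (?f' n w) \<le> norm (?A' n) * exp (- 2 * pi * (\<alpha> + real n) * \<delta>)" if "w \<in> S" for n w
        unfolding norm_mult[of "?A' n"] norm_q_power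
        using that al by (intro mult_left_mono) (auto simp: S_def intro!: mult_left_mono)
    qed
  qed (use S in \<open>auto simp: interior_open\<close>)
  then show ?thesis unfolding q_series_def .
qed

text \<open>
Uniformly in the real part, a cuspidal series decays exponentially towards the cusp. The
quadratic rate recorded here is enough for every later estimate: after the substitution
\<open>y = 1 / (c^2 t)\<close> it also beats the factor \<open>t\<close> to a negative power that comes from the weight.
\<close>
lemma q_series_decay:
  assumes A: "cuspidal_coeffs \<alpha> A"
  obtains K where "K \<ge> 0" "\<And>\<tau>. Im \<tau> \<ge> 1 \<Longrightarrow> norm (q_series \<alpha> A \<tau>) \<le> K / (Im \<tau>)\<^sup>2"
proof -
  have al: "\<alpha> \<ge> 0" using A by (simp add: cuspidal_coeffs_def)
  \<comment> \<open>The smallest exponent that can occur; it is positive because the constant term vanishes.\<close>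
  define \<mu> where "\<mu> = (if \<alpha> = 0 then 1 else \<alpha>)"
  have \<mu>: "\<mu> > 0" using al by (auto simp: \<mu>_def)
  have \<mu>_le: "\<mu> \<le> \<alpha> + real n" if "A n \<noteq> 0" for n
    using A that by (cases "n = 0") (auto simp: \<mu>_def cuspidal_coeffs_def)
  define t where "t = (\<lambda>n. norm (A n) * exp (- 2 * pi * (\<alpha> + real n) * (1/2)))"
  have t: "summable t" unfolding t_def by (rule cuspidal_coeffs_summable[OF A]) simp
  define K where "K = 2 / (pi * \<mu>)\<^sup>2 * suminf t"
  have t0: "t n \<ge> 0" for n by (simp add: t_def)
  show thesis
  proof (rule that)
    show "K \<ge> 0" unfolding K_def using t t0 by (intro mult_nonneg_nonneg suminf_nonneg) auto
    fix \<tau> :: complex assume \<tau>: "Im \<tau> \<ge> 1"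
    define y where "y = Im \<tau>"
    have y: "y \<ge> 1" using \<tau> by (simp add: y_def)
    have le: "norm (A n * q_power \<tau> (\<alpha> + real n)) \<le> 2 / (pi * \<mu> * y)\<^sup>2 * t n" for n
    proof (cases "A n = 0")
      case True then show ?thesis by (simp add: t_def)
    next
      case False
      define l where "l = \<alpha> + real n"
      have l: "l \<ge> \<mu>" using \<mu>_le[OF False] by (simp add: l_def)
      have "exp (pi * \<mu> * y) \<ge> (pi * \<mu> * y)\<^sup>2 / 2"
      proof -
        have "0 \<le> pi * \<mu> * y" using \<mu> y by simp
        from exp_lower_Taylor_quadratic[OF this] this show ?thesis by linarith
      qed
      then have 1: "exp (- (pi * \<mu> * y)) \<le> 2 / (pi * \<mu> * y)\<^sup>2"
        using \<mu> y by (simp add: exp_minus divide_simps)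
      have "exp (- 2 * pi * l * y) = exp (- (pi * l * y)) * exp (- (pi * l * y))"
        by (simp add: exp_add [symmetric])
      also have "\<dots> \<le> exp (- (pi * \<mu> * y)) * exp (- (pi * l * 1))"
        using l \<mu> y by (intro mult_mono) (auto intro!: mult_mono mult_left_mono)
      also have "\<dots> \<le> 2 / (pi * \<mu> * y)\<^sup>2 * exp (- 2 * pi * l * (1/2))"
        using 1 by (intro mult_mono) auto
      finally show ?thesis
        unfolding norm_mult norm_q_power t_def l_def[symmetric] y_def[symmetric]
        by (metis mult.left_commute mult_left_mono norm_ge_zero)
    qed
    have s: "summable (\<lambda>n. norm (A n * q_power \<tau> (\<alpha> + real n)))"
      using \<tau> by (intro summable_q_series[OF A]) auto
    have "norm (q_series \<alpha> A \<tau>) \<le> (\<Sum>n. norm (A n * q_power \<tau> (\<alpha> + real n)))"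
      unfolding q_series_def using s by (rule summable_norm)
    also have "\<dots> \<le> (\<Sum>n. 2 / (pi * \<mu> * y)\<^sup>2 * t n)"
      using le s summable_mult[OF t] by (rule suminf_le)
    also have "\<dots> = 2 / (pi * \<mu> * y)\<^sup>2 * suminf t" using t by (rule suminf_mult)
    also have "\<dots> = K / (Im \<tau>)\<^sup>2" using y \<mu> by (simp add: K_def y_def power_mult_distrib)
    finally show "norm (q_series \<alpha> A \<tau>) \<le> K / (Im \<tau>)\<^sup>2" .
  qed
qed

text \<open>
Positivity of the smallest exponent bounds the factor \<open>l powr (-1/2)\<close>.
\<close>
lemma cuspidal_coeffs_inv_sqrt:
  assumes "cuspidal_coeffs \<alpha> A"
  shows "cuspidal_coeffs \<alpha> (\<lambda>n. of_real ((\<alpha> + real n) powr (-1/2)) * A n)"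
proof (rule cuspidal_coeffs_mult[OF assms])
  fix n assume n: "A n \<noteq> 0"
  have al: "0 \<le> \<alpha>" using assms by (simp add: cuspidal_coeffs_def)
  define \<mu> where "\<mu> = (if \<alpha> = 0 then 1 else \<alpha>)"
  have \<mu>: "\<mu> > 0" using al by (auto simp: \<mu>_def)
  have \<mu>_le: "\<mu> \<le> \<alpha> + real n"
    using assms n by (cases "n = 0") (auto simp: \<mu>_def cuspidal_coeffs_def)
  have "(\<alpha> + real n) powr (-1/2) \<le> \<mu> powr (-1/2) * 1"
    unfolding mult_1_right using \<mu> \<mu>_le by (intro powr_mono2') simp_all
  also have "\<dots> \<le> \<mu> powr (-1/2) * (1 + (\<alpha> + real n))"
    using al by (intro mult_left_mono) auto
  finally show "norm (of_real ((\<alpha> + real n) powr (-1/2)) :: complex) \<le> \<mu> powr (-1/2) * (1 + (\<alpha> + real n))"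
    unfolding norm_of_real by simp
qed

lemma cuspidal_coeffs_pos:
  assumes "cuspidal_coeffs \<alpha> A" "A n \<noteq> 0"
  shows "\<alpha> + real n > 0"
proof (cases "n = 0")
  case True
  then show ?thesis using assms unfolding cuspidal_coeffs_def by (metis add_0_right of_nat_0 order_less_le)
next
  case False
  then show ?thesis using assms(1) unfolding cuspidal_coeffs_def by simp
qed

text \<open>
The exponent of the Eichler integral is \<open>1 - \<kappa> = N/2 - 1\<close>, where \<open>N = 4 - 2 \<kappa>\<close> is 3 for weight
\<open>1/2\<close> and 1 for weight \<open>3/2\<close>. The integer \<open>N\<close> replaces the weight from here on.
\<close>
lemma cuspidal_coeffs_eichler:
  assumes A: "cuspidal_coeffs \<alpha> A" and N: "N = 1 \<or> N = 3"
  shows "cuspidal_coeffs \<alpha> (\<lambda>n. of_real ((\<alpha> + real n) powr (real N / 2 - 1)) * A n)"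
  using N
proof
  assume N: "N = 1"
  have e: "real N / 2 - 1 = -1/2" using N by simp
  show ?thesis unfolding e by (rule cuspidal_coeffs_inv_sqrt[OF A])
next
  assume N: "N = 3"
  have e: "real N / 2 - 1 = 1/2" using N by simp
  show ?thesis unfolding e
  proof (rule cuspidal_coeffs_mult[OF A])
    fix n
    have l: "\<alpha> + real n \<ge> 0" using A by (simp add: cuspidal_coeffs_def)
    have "x \<le> (1 + x)\<^sup>2" if "x \<ge> 0" for x :: real
      using that zero_le_power2[of x] unfolding power2_sum power_one by linarith
    from this[OF l] have "\<alpha> + real n \<le> (1 + (\<alpha> + real n))\<^sup>2" .
    then have "sqrt (\<alpha> + real n) \<le> 1 + (\<alpha> + real n)" using l by (intro real_le_lsqrt) auto
    then show "norm (of_real ((\<alpha> + real n) powr (1/2)) :: complex) \<le> 1 * (1 + (\<alpha> + real n))"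
      unfolding norm_of_real powr_half_sqrt[OF l] using l by simp
  qed
qed

lemma q_series_holomorphic:
  assumes "cuspidal_coeffs \<alpha> A"
  shows "q_series \<alpha> A holomorphic_on {\<tau>. Im \<tau> > 0}"
proof (rule holomorphic_onI)
  fix \<tau> assume "\<tau> \<in> {\<tau>. Im \<tau> > 0}"
  then have "Im \<tau> > 0" by simp
  from q_series_has_field_derivative[OF assms this]
  show "q_series \<alpha> A field_differentiable at \<tau> within {\<tau>. Im \<tau> > 0}"
    using field_differentiable_at_within field_differentiable_def by blast
qed

lemma q_series_translate:
  assumes A: "cuspidal_coeffs \<alpha> A" and \<tau>: "Im \<tau> > 0"
  shows "q_series \<alpha> A (\<tau> + of_int m) = exp (2 * of_real pi * \<i> * of_real \<alpha> * of_int m) * q_series \<alpha> A \<tau>"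
proof -
  let ?e = "exp (2 * of_real pi * \<i> * of_real \<alpha> * of_int m)"
  have "q_power (\<tau> + of_int m) (\<alpha> + real n) = ?e * q_power \<tau> (\<alpha> + real n)" for n
  proof -
    have "q_power (of_int m) (\<alpha> + real n) = ?e * exp (2 * of_real pi * \<i> * of_int (int n * m))"
      unfolding q_power_def exp_add[symmetric] by (rule arg_cong[of _ _ exp]) (simp add: algebra_simps)
    also have "exp (2 * of_real pi * \<i> * of_int (int n * m)) = 1"
      unfolding exp_eq_1 by (intro conjI exI[of _ "int n * m"]) simp_all
    finally show ?thesis unfolding q_power_add by simp
  qed
  then have "q_series \<alpha> A (\<tau> + of_int m) = (\<Sum>n. ?e * (A n * q_power \<tau> (\<alpha> + real n)))"
    unfolding q_series_def by (simp add: mult_ac)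
  also have "\<dots> = ?e * q_series \<alpha> A \<tau>"
    unfolding q_series_def by (rule suminf_mult[OF summable_norm_cancel[OF summable_q_series[OF A \<tau>]]])
  finally show ?thesis .
qed

lemma has_sum_q_exponents_iff:
  fixes f :: "real \<Rightarrow> complex"
  shows "(f has_sum s) (q_exponents \<alpha>) \<longleftrightarrow>
    ((\<lambda>n. if \<alpha> + real n > 0 then f (\<alpha> + real n) else 0) has_sum s) UNIV"
proof -
  have eq: "q_exponents \<alpha> = (\<lambda>n. \<alpha> + real n) ` {n. \<alpha> + real n > 0}"
    by (auto simp: q_exponents_def)
  have "(f has_sum s) (q_exponents \<alpha>) \<longleftrightarrow> ((\<lambda>n. f (\<alpha> + real n)) has_sum s) {n. \<alpha> + real n > 0}"
    unfolding eq by (subst has_sum_reindex) (auto simp: inj_on_def o_def)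
  also have "\<dots> \<longleftrightarrow> ((\<lambda>n. if \<alpha> + real n > 0 then f (\<alpha> + real n) else 0) has_sum s) UNIV"
    by (rule has_sum_cong_neutral) auto
  finally show ?thesis .
qed

text \<open>
For \<open>\<alpha> = 0\<close> the index 0 does not correspond to an
element of \<open>q_exponents\<close> and gets the coefficient 0.
\<close>
definition expansion_coeffs :: "real \<Rightarrow> (real \<Rightarrow> complex) \<Rightarrow> nat \<Rightarrow> complex"
  where "expansion_coeffs \<alpha> a n = (if \<alpha> + real n > 0 then a (\<alpha> + real n) else 0)"

text \<open>
Unconditional summability of complex numbers is absolute, so the expansions at the points
\<open>i y\<close> yield the convergence required of cuspidal coefficients.
\<close>
lemma expansion_coeffs_cuspidal:
  assumes \<alpha>: "\<alpha> \<ge> 0"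
    and exp: "\<And>\<tau>. Im \<tau> > 0 \<Longrightarrow> ((\<lambda>l. a l * q_power \<tau> l) has_sum f \<tau>) (q_exponents \<alpha>)"
  shows "cuspidal_coeffs \<alpha> (expansion_coeffs \<alpha> a)"
    and "Im \<tau> > 0 \<Longrightarrow> f \<tau> = q_series \<alpha> (expansion_coeffs \<alpha> a) \<tau>"
proof -
  have has: "((\<lambda>n. expansion_coeffs \<alpha> a n * q_power \<tau> (\<alpha> + real n)) has_sum f \<tau>) UNIV" if "Im \<tau> > 0" for \<tau>
  proof -
    have "(if \<alpha> + real n > 0 then a (\<alpha> + real n) * q_power \<tau> (\<alpha> + real n) else 0)
       = expansion_coeffs \<alpha> a n * q_power \<tau> (\<alpha> + real n)" for n
      by (simp add: expansion_coeffs_def)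
    with exp[OF that] show ?thesis unfolding has_sum_q_exponents_iff by simp
  qed
  show "cuspidal_coeffs \<alpha> (expansion_coeffs \<alpha> a)"
    unfolding cuspidal_coeffs_def
  proof (intro conjI allI impI)
    fix y :: real assume y: "y > 0"
    have "Im (\<i> * of_real y) > 0" using y by simp
    from has[OF this] have "(\<lambda>n. expansion_coeffs \<alpha> a n * q_power (\<i> * of_real y) (\<alpha> + real n)) summable_on UNIV"
      by (rule has_sum_imp_summable)
    then have "(\<lambda>n. norm (expansion_coeffs \<alpha> a n * q_power (\<i> * of_real y) (\<alpha> + real n))) summable_on UNIV"
      by (simp only: summable_on_iff_abs_summable_on_complex)
    then have "summable (\<lambda>n. norm (expansion_coeffs \<alpha> a n * q_power (\<i> * of_real y) (\<alpha> + real n)))"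
      by (rule summable_on_imp_summable)
    then show "summable (\<lambda>n. norm (expansion_coeffs \<alpha> a n) * exp (- 2 * pi * (\<alpha> + real n) * y))"
      unfolding norm_mult norm_q_power by simp
  qed (use \<alpha> in \<open>auto simp: expansion_coeffs_def\<close>)
  show "f \<tau> = q_series \<alpha> (expansion_coeffs \<alpha> a) \<tau>" if "Im \<tau> > 0"
    unfolding q_series_def by (rule sums_unique[OF has_sum_imp_sums[OF has[OF that]]])
qed

lemma eichler_integral_q_series:
  assumes A: "cuspidal_coeffs (\<alpha> k) (expansion_coeffs (\<alpha> k) (a k))" and N: "N = 1 \<or> N = 3"
    and \<kappa>: "1 - \<kappa> = real N / 2 - 1" and \<tau>: "Im \<tau> > 0"
  shows "eichler_integral \<kappa> \<alpha> a \<tau> $ k =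
    q_series (\<alpha> k) (\<lambda>n. of_real ((\<alpha> k + real n) powr (real N / 2 - 1)) * expansion_coeffs (\<alpha> k) (a k) n) \<tau>"
proof -
  let ?B = "\<lambda>n. of_real ((\<alpha> k + real n) powr (real N / 2 - 1)) * expansion_coeffs (\<alpha> k) (a k) n"
  note s = summable_q_series[OF cuspidal_coeffs_eichler[OF A N] \<tau>]
  have "((\<lambda>n. ?B n * q_power \<tau> (\<alpha> k + real n)) has_sum q_series (\<alpha> k) ?B \<tau>) UNIV"
    unfolding q_series_def
    by (rule norm_summable_imp_has_sum[OF s summable_sums[OF summable_norm_cancel[OF s]]])
  moreover have "?B n * q_power \<tau> (\<alpha> k + real n) = (if \<alpha> k + real n > 0
      then of_real ((\<alpha> k + real n) powr (real N / 2 - 1)) * a k (\<alpha> k + real n) * q_power \<tau> (\<alpha> k + real n) else 0)" for n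
    by (simp add: expansion_coeffs_def)
  ultimately have "((\<lambda>l. of_real (l powr (real N / 2 - 1)) * a k l * q_power \<tau> l) has_sum q_series (\<alpha> k) ?B \<tau>) (q_exponents (\<alpha> k))"
    unfolding has_sum_q_exponents_iff by simp
  then show ?thesis unfolding eichler_integral_def \<kappa> by (simp add: infsumI)
qed

section \<open>The half-integral as a Gaussian limit\<close>

lemma gaussian_half_line:
  fixes l :: real
  assumes "l > 0"
  shows "has_bochner_integral lborel (\<lambda>r. indicator {0..} r *\<^sub>R exp (- 2 * pi * l * r\<^sup>2))
           (l powr (-1/2) / (2 * sqrt 2))"
proof -
  define c where "c = sqrt (2 * pi * l)"
  have c: "c > 0" "c\<^sup>2 = 2 * pi * l" using assms by (auto simp: c_def)
  have 1: "has_bochner_integral lborel (\<lambda>x. indicator {0..} (0 + c * x) *\<^sub>R exp (- (0 + c * x)\<^sup>2)) ((sqrt pi / 2) /\<^sub>R \<bar>c\<bar>)"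
  proof (rule lborel_has_bochner_integral_real_affine_iff[THEN iffD1])
    show "c \<noteq> 0" using c by simp
  qed (rule gaussian_moment_0)
  have 2: "indicator {0..} (0 + c * x) = (indicator {0..} x :: real)" for x
    using c(1) by (auto simp: indicator_def zero_le_mult_iff)
  have 3: "- (0 + c * x)\<^sup>2 = - 2 * pi * l * x\<^sup>2" for x
    using c(2) by (simp add: power_mult_distrib)
  have "(sqrt pi / 2) /\<^sub>R \<bar>c\<bar> = (sqrt pi / c) / 2"
    unfolding real_scaleR_def abs_of_pos[OF c(1)] divide_inverse by (simp only: mult_ac)
  also have "sqrt pi / c = 1 / (sqrt 2 * sqrt l)"
    using assms by (simp add: c_def real_sqrt_mult)
  also have "\<dots> = l powr (-1/2) / sqrt 2"
  proof -
    have "l powr (-1/2) = 1 / sqrt l"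
      using assms powr_half_sqrt[of l] powr_minus_divide[of l "1/2"] by simp
    then show ?thesis by simp
  qed
  finally have 4: "(sqrt pi / 2) /\<^sub>R \<bar>c\<bar> = l powr (-1/2) / (2 * sqrt 2)"
    by simp
  from 1 show ?thesis unfolding 2 3 4 .
qed

lemma cis_pi4_square: "(cis (pi/4))\<^sup>2 = \<i>"
proof -
  have a: "pi/4 + pi/4 = pi/2" by linarith
  show ?thesis unfolding power2_eq_square cis_mult a cis_pi_half ..
qed

text \<open>
This domain is where \<open>\<tau> + z^2\<close> lies in the upper half-plane: the double cover of the
half-plane branched at \<open>\<tau>\<close>. It is star-shaped because \<open>z \<mapsto> u z\<close> moves \<open>\<tau> + z^2\<close> along a
straight line towards \<open>\<tau>\<close>. On it the kernel \<open>(w - \<tau>)^(1/2)\<close> is the single-valued function \<open>z\<close>.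
\<close>
lemma shifted_square_domain:
  assumes \<tau>: "Im \<tau> > 0"
  shows open_shifted_square: "open {z. Im (\<tau> + z\<^sup>2) > 0}"
    and starlike_shifted_square: "starlike {z. Im (\<tau> + z\<^sup>2) > 0}"
proof -
  define \<Omega> where "\<Omega> = {z. Im (\<tau> + z\<^sup>2) > 0}"
  have open\<Omega>: "open \<Omega>"
    unfolding \<Omega>_def by (intro open_Collect_less continuous_intros)
  have star: "starlike \<Omega>"
    unfolding starlike_def
  proof (intro bexI ballI subsetI)
    show "0 \<in> \<Omega>" using \<tau> by (simp add: \<Omega>_def)
    fix z x assume z: "z \<in> \<Omega>" and "x \<in> closed_segment 0 z"
    then obtain u where u: "0 \<le> u" "u \<le> 1" "x = u *\<^sub>R z" by (auto simp: in_segment)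
    have "Im (\<tau> + x\<^sup>2) = (1 - u\<^sup>2) * Im \<tau> + u\<^sup>2 * Im (\<tau> + z\<^sup>2)"
    proof -
      have "x\<^sup>2 = u\<^sup>2 *\<^sub>R z\<^sup>2" using u(3) by (simp add: scaleR_power)
      then show ?thesis by (simp add: algebra_simps)
    qed
    moreover have "(1 - u\<^sup>2) * Im \<tau> \<ge> 0" "u\<^sup>2 * Im (\<tau> + z\<^sup>2) \<ge> 0" "u\<^sup>2 * Im (\<tau> + z\<^sup>2) > 0 \<or> u = 0"
      using u \<tau> z by (auto simp: \<Omega>_def power_le_one intro!: mult_nonneg_nonneg)
    ultimately show "x \<in> \<Omega>" using \<tau> u by (auto simp: \<Omega>_def)
  qed
  show "open {z. Im (\<tau> + z\<^sup>2) > 0}" "starlike {z. Im (\<tau> + z\<^sup>2) > 0}"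
    using open\<Omega> star by (simp_all only: \<Omega>_def)
qed

definition gauss_const :: complex
  where "gauss_const = cis (pi/4) * (1 / (2 * sqrt 2))"

lemma gauss_const_nonzero: "gauss_const \<noteq> 0"
  unfolding gauss_const_def by (simp only: mult_eq_0_iff cis_neq_zero of_real_eq_0_iff divide_eq_0_iff) simp

text \<open>
Along the ray \<open>z = cis (pi/4) r\<close> one has \<open>z^2 = i r^2\<close>, so the term with exponent \<open>l\<close> becomes a
Gaussian in \<open>r\<close> whose integral is a multiple of \<open>l powr (-1/2)\<close>. Integrating term by term turns
the primitive into the half-integrated series. Oddness fixes the constant of integration; it
can be arranged since the integrand is even.
\<close>
lemma q_series_half_primitive:
  assumes A: "cuspidal_coeffs \<alpha> A" and \<tau>: "Im \<tau> > 0"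
  obtains S where
    "\<And>z. Im (\<tau> + z\<^sup>2) > 0 \<Longrightarrow> (S has_field_derivative q_series \<alpha> A (\<tau> + z\<^sup>2)) (at z)"
    "\<And>z. S (-z) = - S z"
    "((\<lambda>R. S (cis (pi/4) * of_real R)) \<longlongrightarrow>
       gauss_const * q_series \<alpha> (\<lambda>n. of_real ((\<alpha> + real n) powr (-1/2)) * A n) \<tau>) at_top"
proof -
  let ?f = "q_series \<alpha> A"
  let ?e = "cis (pi/4)"
  define \<Omega> where "\<Omega> = {z. Im (\<tau> + z\<^sup>2) > 0}"
  note open\<Omega> = open_shifted_square[OF \<tau>, folded \<Omega>_def]
  note star = starlike_shifted_square[OF \<tau>, folded \<Omega>_def]
  have der: "((\<lambda>z. ?f (\<tau> + z\<^sup>2)) has_field_derivative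
      (q_series \<alpha> (\<lambda>n. (2 * of_real pi * \<i> * of_real (\<alpha> + real n)) * A n) (\<tau> + z\<^sup>2)) * (2 * z)) (at z)"
    if "z \<in> \<Omega>" for z
    by (rule DERIV_chain2[OF q_series_has_field_derivative[OF A]])
       (use that in \<open>auto simp: \<Omega>_def intro!: derivative_eq_intros\<close>)
  have cont: "continuous_on \<Omega> (\<lambda>z. ?f (\<tau> + z\<^sup>2))"
    using der by (meson DERIV_isCont continuous_at_imp_continuous_on)
  obtain P where P: "\<And>z. z \<in> \<Omega> \<Longrightarrow> (P has_field_derivative ?f (\<tau> + z\<^sup>2)) (at z)"
    using holomorphic_starlike_primitive[OF cont star open\<Omega>, of "{}"] der
    by (auto simp: field_differentiable_def)
  define S where "S = (\<lambda>z. (P z - P (-z)) / 2)"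
  have S: "(S has_field_derivative ?f (\<tau> + z\<^sup>2)) (at z)" if "z \<in> \<Omega>" for z
  proof -
    have "-z \<in> \<Omega>" using that by (simp add: \<Omega>_def)
    from P[OF this] have "(P has_field_derivative ?f (\<tau> + z\<^sup>2)) (at (-z))" by simp
    then have "((\<lambda>z. P (-z)) has_field_derivative ?f (\<tau> + z\<^sup>2) * (-1)) (at z)"
      by (rule DERIV_chain2) (auto intro!: derivative_eq_intros)
    with P[OF that] show ?thesis unfolding S_def
      by (auto intro!: derivative_eq_intros)
  qed
  define a where "a = (\<lambda>n. A n * q_power \<tau> (\<alpha> + real n))"
  define h where "h = (\<lambda>n r. indicator {0..} r *\<^sub>R (a n * of_real (exp (- 2 * pi * (\<alpha> + real n) * r\<^sup>2))))"
  have bochner: "has_bochner_integral lborel (h n) (a n * of_real ((\<alpha> + real n) powr (-1/2) / (2 * sqrt 2)))" 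
    "has_bochner_integral lborel (\<lambda>r. norm (h n r)) (norm (a n) * ((\<alpha> + real n) powr (-1/2) / (2 * sqrt 2)))" for n
  proof -
    have "has_bochner_integral lborel (\<lambda>r. c * (indicator {0..} r *\<^sub>R exp (- 2 * pi * (\<alpha> + real n) * r\<^sup>2))) (c * ((\<alpha> + real n) powr (-1/2) / (2 * sqrt 2)))" 
      if "c = 0 \<longleftrightarrow> a n = 0" for c
    proof (cases "c = 0")
      case False
      then have "A n \<noteq> 0" using that by (auto simp: a_def)
      from cuspidal_coeffs_pos[OF A this] show ?thesis
        by (intro has_bochner_integral_mult_right gaussian_half_line)
    qed (simp add: has_bochner_integral_zero)
    from this[of "norm (a n)"] show "has_bochner_integral lborel (\<lambda>r. norm (h n r)) (norm (a n) * ((\<alpha> + real n) powr (-1/2) / (2 * sqrt 2)))"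
      by (simp add: h_def norm_mult mult_ac)
    have "has_bochner_integral lborel (\<lambda>r. a n * of_real (indicator {0..} r *\<^sub>R exp (- 2 * pi * (\<alpha> + real n) * r\<^sup>2))) (a n * of_real ((\<alpha> + real n) powr (-1/2) / (2 * sqrt 2)))"
    proof (cases "a n = 0")
      case False
      then have "A n \<noteq> 0" by (auto simp: a_def)
      from cuspidal_coeffs_pos[OF A this] show ?thesis
        by (intro has_bochner_integral_mult_right has_bochner_integral_of_real gaussian_half_line)
    qed (simp add: has_bochner_integral_zero)
    then show "has_bochner_integral lborel (h n) (a n * of_real ((\<alpha> + real n) powr (-1/2) / (2 * sqrt 2)))"
      by (simp add: h_def scaleR_conv_of_real mult_ac)
  qed
  have expand: "q_power (\<tau> + \<i> * of_real (r\<^sup>2)) l = q_power \<tau> l * of_real (exp (- 2 * pi * l * r\<^sup>2))" for r l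
  proof -
    have "q_power (\<i> * of_real (r\<^sup>2)) l = exp (of_real (- 2 * pi * l * r\<^sup>2))"
      unfolding q_power_def by (rule arg_cong[of _ _ exp]) (simp add: complex_eq_iff)
    then show ?thesis unfolding q_power_add exp_of_real by (rule arg_cong)
  qed
  have h_sum: "summable (\<lambda>n. norm (h n r))" "(\<Sum>n. h n r) = indicator {0..} r *\<^sub>R ?f (\<tau> + \<i> * of_real (r\<^sup>2))" for r
  proof -
    have pos: "Im (\<tau> + \<i> * of_real (r\<^sup>2)) > 0" using \<tau> by (simp add: add_pos_nonneg)
    have eq: "h n r = indicator {0..} r *\<^sub>R (A n * q_power (\<tau> + \<i> * of_real (r\<^sup>2)) (\<alpha> + real n))" for n
      unfolding h_def expand a_def by (simp only: mult.assoc)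
    note s = summable_q_series[OF A pos]
    show "summable (\<lambda>n. norm (h n r))"
      unfolding eq norm_scaleR using s by (rule summable_mult)
    show "(\<Sum>n. h n r) = indicator {0..} r *\<^sub>R ?f (\<tau> + \<i> * of_real (r\<^sup>2))"
      unfolding eq q_series_def using summable_norm_cancel[OF s] by (rule suminf_scaleR_right [symmetric])
  qed
  have int: "integrable lborel (h n)" for n
    using bochner(1) by (simp add: has_bochner_integral_iff)
  have sumint: "summable (\<lambda>n. LINT r|lborel. norm (h n r))"
  proof -
    have "summable (\<lambda>n. norm (of_real ((\<alpha> + real n) powr (-1/2)) * A n * q_power \<tau> (\<alpha> + real n)) / (2 * sqrt 2))"
      by (intro summable_divide summable_q_series cuspidal_coeffs_inv_sqrt A \<tau>)
    also have "(\<lambda>n. norm (of_real ((\<alpha> + real n) powr (-1/2)) * A n * q_power \<tau> (\<alpha> + real n)) / (2 * sqrt 2)) = (\<lambda>n. LINT r|lborel. norm (h n r))"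
      using bochner(2) by (simp add: has_bochner_integral_iff a_def norm_mult mult_ac)
    finally show ?thesis .
  qed
  let ?g = "\<lambda>r. indicator {0..} r *\<^sub>R ?f (\<tau> + \<i> * of_real (r\<^sup>2))"
  have g_int: "integrable lborel ?g"
    using integrable_suminf[OF int AE_I2 sumint] h_sum by simp
  have "integral\<^sup>L lborel ?g = (\<Sum>n. a n * of_real ((\<alpha> + real n) powr (-1/2) / (2 * sqrt 2)))"
    using integral_suminf[OF int AE_I2 sumint] h_sum bochner(1) by (simp add: has_bochner_integral_iff)
  also have "\<dots> = (\<Sum>n. (1 / (2 * sqrt 2)) * (of_real ((\<alpha> + real n) powr (-1/2)) * A n * q_power \<tau> (\<alpha> + real n)))"
    by (simp add: a_def mult_ac)
  also have "\<dots> = (1 / (2 * sqrt 2)) * q_series \<alpha> (\<lambda>n. of_real ((\<alpha> + real n) powr (-1/2)) * A n) \<tau>"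
    unfolding q_series_def
    by (intro suminf_mult summable_norm_cancel[OF summable_q_series[OF cuspidal_coeffs_inv_sqrt[OF A] \<tau>]])
  finally have lim: "((\<lambda>R. LINT r|lborel. indicator {..R} r *\<^sub>R ?g r) \<longlongrightarrow>
      (1 / (2 * sqrt 2)) * q_series \<alpha> (\<lambda>n. of_real ((\<alpha> + real n) powr (-1/2)) * A n) \<tau>) at_top"
    using tendsto_integral_at_top[OF _ g_int] by simp
  have ray: "Im (\<tau> + (?e * of_real r)\<^sup>2) > 0" "(?e * of_real r)\<^sup>2 = \<i> * of_real (r\<^sup>2)" for r
    using \<tau> by (auto simp: power_mult_distrib cis_pi4_square add_pos_nonneg)
  have FTC: "S (?e * of_real R) = ?e * (LINT r|lborel. indicator {..R} r *\<^sub>R ?g r)" if "R \<ge> 0" for R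
  proof -
    have "(LINT r|lborel. indicator {0..R} r *\<^sub>R (?e * ?f (\<tau> + \<i> * of_real (r\<^sup>2)))) = S (?e * of_real R) - S (?e * of_real 0)"
    proof (rule integral_FTC_atLeastAtMost[OF that])
      fix r
      have "((\<lambda>r. S (?e * of_real r)) has_vector_derivative (?e * 1) * ?f (\<tau> + (?e * of_real r)\<^sup>2)) (at r within {0..R})"
      proof (rule field_vector_diff_chain_within[where g = S, unfolded o_def])
        show "((\<lambda>r. ?e * of_real r) has_vector_derivative ?e * 1) (at r within {0..R})"
          by (intro has_vector_derivative_mult_right) (auto intro!: derivative_eq_intros)
        have "?e * of_real r \<in> \<Omega>" using ray(1) by (simp only: \<Omega>_def mem_Collect_eq)
        from S[OF this] show "(S has_field_derivative ?f (\<tau> + (?e * of_real r)\<^sup>2))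
            (at (?e * of_real r) within (\<lambda>r. ?e * of_real r) ` {0..R})"
          by (rule has_field_derivative_at_within)
      qed
      then show "((\<lambda>r. S (?e * of_real r)) has_vector_derivative ?e * ?f (\<tau> + \<i> * of_real (r\<^sup>2))) (at r within {0..R})"
        by (simp only: ray(2) mult_1_right)
      have "continuous_on {0..R} ((\<lambda>z. ?f (\<tau> + z\<^sup>2)) \<circ> (\<lambda>r. ?e * of_real r))"
        by (rule continuous_on_compose[OF _ continuous_on_subset[OF cont]])
           (use ray(1) in \<open>auto simp only: \<Omega>_def mem_Collect_eq intro!: continuous_intros\<close>)
      then show "continuous_on {0..R} (\<lambda>r. ?e * ?f (\<tau> + \<i> * of_real (r\<^sup>2)))"
        by (intro continuous_intros) (simp only: o_def ray(2))
    qed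
    moreover have "S 0 = 0" by (simp add: S_def)
    moreover have "indicator {0..R} r *\<^sub>R (?e * ?f (\<tau> + \<i> * of_real (r\<^sup>2))) = ?e * (indicator {..R} r *\<^sub>R ?g r)" for r
      by (auto simp: indicator_def)
    ultimately show ?thesis by (simp only: of_real_0 mult_zero_right diff_zero integral_mult_right_zero)
  qed
  show thesis
  proof (rule that[of S])
    show "(S has_field_derivative ?f (\<tau> + z\<^sup>2)) (at z)" if "Im (\<tau> + z\<^sup>2) > 0" for z
      using S that by (simp add: \<Omega>_def)
    show "S (-z) = - S z" for z by (simp add: S_def field_simps)
    have "((\<lambda>R. ?e * (LINT r|lborel. indicator {..R} r *\<^sub>R ?g r)) \<longlongrightarrow>
      ?e * ((1 / (2 * sqrt 2)) * q_series \<alpha> (\<lambda>n. of_real ((\<alpha> + real n) powr (-1/2)) * A n) \<tau>)) at_top"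
      by (rule tendsto_mult_left[OF lim])
    then have "((\<lambda>R. ?e * (LINT r|lborel. indicator {..R} r *\<^sub>R ?g r)) \<longlongrightarrow>
      gauss_const * q_series \<alpha> (\<lambda>n. of_real ((\<alpha> + real n) powr (-1/2)) * A n) \<tau>) at_top"
      unfolding gauss_const_def by (simp only: mult.assoc)
    moreover have "eventually (\<lambda>R. ?e * (LINT r|lborel. indicator {..R} r *\<^sub>R ?g r) = S (?e * of_real R)) at_top"
      using eventually_ge_at_top[of 0] by eventually_elim (simp add: FTC)
    ultimately show "((\<lambda>R. S (cis (pi/4) * of_real R)) \<longlongrightarrow>
       gauss_const * q_series \<alpha> (\<lambda>n. of_real ((\<alpha> + real n) powr (-1/2)) * A n) \<tau>) at_top"
      by (auto elim: Lim_transform_eventually)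
  qed
qed

section \<open>Odd primitives on the double cover\<close>

text \<open>
In the coordinate \<open>w = \<tau> + z^2\<close> this is a primitive of \<open>g(w) (w - \<tau>)^(-N/2) dw\<close>. For \<open>N = 3\<close> that
form is not integrable at \<open>w = \<tau>\<close>; requiring the primitive to be odd in \<open>z\<close> is the
regularisation, since a nonzero constant is not odd. It makes the primitive unique, which is
what the transformation law below relies on.
\<close>
definition odd_primitive :: "nat \<Rightarrow> (complex \<Rightarrow> complex) \<Rightarrow> complex \<Rightarrow> (complex \<Rightarrow> complex) \<Rightarrow> bool"
  where "odd_primitive N g \<tau> P \<longleftrightarrow>
    (\<forall>z. z \<noteq> 0 \<longrightarrow> Im (\<tau> + z\<^sup>2) > 0 \<longrightarrow> (P has_field_derivative 2 * g (\<tau> + z\<^sup>2) / z ^ (N - 1)) (at z)) \<and>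
    (\<forall>z. P (-z) = - P z)"

text \<open>
The ratio between the limit of the odd primitive towards the cusp and the Eichler integral:
twice a Gaussian constant for \<open>N = 1\<close>, and four times that constant times the factor
\<open>2 pi i\<close> of a differentiation for \<open>N = 3\<close>.
\<close>
definition eichler_const :: "nat \<Rightarrow> complex"
  where "eichler_const N = gauss_const * (if N = 1 then 2 else 8 * of_real pi * \<i>)"

lemma eichler_const_nonzero: "eichler_const N \<noteq> 0"
  using gauss_const_nonzero by (simp add: eichler_const_def)

lemma odd_primitiveD:
  assumes "odd_primitive N g \<tau> P"
  shows "z \<noteq> 0 \<Longrightarrow> Im (\<tau> + z\<^sup>2) > 0 \<Longrightarrow> (P has_field_derivative 2 * g (\<tau> + z\<^sup>2) / z ^ (N - 1)) (at z)"
    and "P (-z) = - P z"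
  using assms unfolding odd_primitive_def by auto

lemma odd_primitive_1:
  assumes A: "cuspidal_coeffs \<alpha> A" and \<tau>: "Im \<tau> > 0"
  obtains P where "odd_primitive 1 (q_series \<alpha> A) \<tau> P"
    "((\<lambda>R. P (cis (pi/4) * of_real R)) \<longlongrightarrow>
       eichler_const 1 * q_series \<alpha> (\<lambda>n. of_real ((\<alpha> + real n) powr (-1/2)) * A n) \<tau>) at_top"
proof -
  obtain S where S: "\<And>z. Im (\<tau> + z\<^sup>2) > 0 \<Longrightarrow> (S has_field_derivative q_series \<alpha> A (\<tau> + z\<^sup>2)) (at z)"
    "\<And>z. S (-z) = - S z"
    "((\<lambda>R. S (cis (pi/4) * of_real R)) \<longlongrightarrow>
       gauss_const * q_series \<alpha> (\<lambda>n. of_real ((\<alpha> + real n) powr (-1/2)) * A n) \<tau>) at_top"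
    by (rule q_series_half_primitive[OF assms], rule that) assumption+
  show thesis
  proof (rule that[of "\<lambda>z. 2 * S z"])
    show "odd_primitive 1 (q_series \<alpha> A) \<tau> (\<lambda>z. 2 * S z)"
      unfolding odd_primitive_def using DERIV_cmult[OF S(1), of _ 2] S(2) by simp
    show "((\<lambda>R. 2 * S (cis (pi/4) * of_real R)) \<longlongrightarrow>
       eichler_const 1 * q_series \<alpha> (\<lambda>n. of_real ((\<alpha> + real n) powr (-1/2)) * A n) \<tau>) at_top"
      using tendsto_mult_left[OF S(3), of 2] by (simp add: eichler_const_def mult_ac)
  qed
qed

lemma q_series_cmult:
  assumes "cuspidal_coeffs \<alpha> (\<lambda>n. c * A n)" "c \<noteq> 0" "Im \<tau> > 0"
  shows "q_series \<alpha> (\<lambda>n. c * A n) \<tau> = c * q_series \<alpha> A \<tau>"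
proof -
  have "summable (\<lambda>n. c * (A n * q_power \<tau> (\<alpha> + real n)))"
    using summable_norm_cancel[OF summable_q_series[OF assms(1,3)]] by (simp add: mult.assoc)
  then have "summable (\<lambda>n. A n * q_power \<tau> (\<alpha> + real n))"
    using \<open>c \<noteq> 0\<close> by (simp add: summable_cmult_iff)
  from suminf_mult[OF this, of c] show ?thesis
    unfolding q_series_def by (simp add: mult.assoc)
qed

text \<open>
Integration by parts moves the double pole of \<open>2 g(\<tau> + z^2) / z^2\<close> into the boundary term
\<open>-2 g(\<tau> + z^2) / z\<close>, which is odd and vanishes towards the cusp; the remaining integrand
\<open>4 g'(\<tau> + z^2)\<close> is again a cuspidal series.
\<close>
lemma odd_primitive_3:
  assumes A: "cuspidal_coeffs \<alpha> A" and \<tau>: "Im \<tau> > 0"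
  obtains P where "odd_primitive 3 (q_series \<alpha> A) \<tau> P"
    "((\<lambda>R. P (cis (pi/4) * of_real R)) \<longlongrightarrow>
       eichler_const 3 * q_series \<alpha> (\<lambda>n. of_real ((\<alpha> + real n) powr (1/2)) * A n) \<tau>) at_top"
proof -
  let ?D = "\<lambda>n. (2 * of_real pi * \<i> * of_real (\<alpha> + real n)) * A n"
  let ?g = "q_series \<alpha> A" and ?g' = "q_series \<alpha> ?D"
  let ?e = "cis (pi/4)"
  note D = cuspidal_coeffs_deriv[OF A]
  obtain S where S: "\<And>z. Im (\<tau> + z\<^sup>2) > 0 \<Longrightarrow> (S has_field_derivative ?g' (\<tau> + z\<^sup>2)) (at z)"
    "\<And>z. S (-z) = - S z"
    "((\<lambda>R. S (cis (pi/4) * of_real R)) \<longlongrightarrow>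
       gauss_const * q_series \<alpha> (\<lambda>n. of_real ((\<alpha> + real n) powr (-1/2)) * ?D n) \<tau>) at_top"
    by (rule q_series_half_primitive[OF D \<tau>], rule that) assumption+
  define Q where "Q = q_series \<alpha> (\<lambda>n. of_real ((\<alpha> + real n) powr (1/2)) * A n) \<tau>"
  have coeff: "of_real ((\<alpha> + real n) powr (-1/2)) * ?D n
      = (2 * of_real pi * \<i>) * (of_real ((\<alpha> + real n) powr (1/2)) * A n)" for n
  proof (cases "A n = 0")
    case False
    then have l: "\<alpha> + real n > 0" by (rule cuspidal_coeffs_pos[OF A])
    have "(\<alpha> + real n) powr (-1/2) * (\<alpha> + real n) = (\<alpha> + real n) powr (-1/2 + 1)"
      using l by (simp only: powr_add powr_one)
    also have "-1/2 + 1 = (1/2 :: real)" by simp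
    finally have "of_real ((\<alpha> + real n) powr (-1/2)) * of_real (\<alpha> + real n) = (of_real ((\<alpha> + real n) powr (1/2)) :: complex)"
      by (metis of_real_mult)
    then show ?thesis by (metis mult.assoc mult.commute)
  qed simp
  have "q_series \<alpha> (\<lambda>n. of_real ((\<alpha> + real n) powr (-1/2)) * ?D n) \<tau> = (2 * of_real pi * \<i>) * Q"
    unfolding coeff Q_def
    by (rule q_series_cmult[OF cuspidal_coeffs_inv_sqrt[OF D, unfolded coeff] _ \<tau>]) simp
  note S3 = S(3)[unfolded this]
  define P where "P = (\<lambda>z. 4 * S z - 2 * ?g (\<tau> + z\<^sup>2) / z)"
  show thesis
  proof (rule that[of P])
    show "odd_primitive 3 ?g \<tau> P"
      unfolding odd_primitive_def
    proof (intro conjI allI impI)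
      fix z :: complex assume z: "z \<noteq> 0" "Im (\<tau> + z\<^sup>2) > 0"
      have "((\<lambda>z. ?g (\<tau> + z\<^sup>2)) has_field_derivative ?g' (\<tau> + z\<^sup>2) * (2 * z)) (at z)"
        by (rule DERIV_chain2[where f = ?g and g = "\<lambda>z. \<tau> + z\<^sup>2"])
           (rule q_series_has_field_derivative[OF A z(2)], auto intro!: derivative_eq_intros)
      from DERIV_diff[OF DERIV_cmult[OF S(1)[OF z(2)], of 4] DERIV_divide[OF DERIV_cmult[OF this, of 2] DERIV_ident z(1)]]
      have "(P has_field_derivative 4 * ?g' (\<tau> + z\<^sup>2) -
         (2 * (?g' (\<tau> + z\<^sup>2) * (2 * z)) * z - 2 * ?g (\<tau> + z\<^sup>2) * 1) / (z * z)) (at z)"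
        unfolding P_def .
      also have "4 * ?g' (\<tau> + z\<^sup>2) - (2 * (?g' (\<tau> + z\<^sup>2) * (2 * z)) * z - 2 * ?g (\<tau> + z\<^sup>2) * 1) / (z * z)
        = 2 * ?g (\<tau> + z\<^sup>2) / z ^ (3 - 1)"
        using z(1) by (simp add: field_simps power2_eq_square)
      finally show "(P has_field_derivative 2 * ?g (\<tau> + z\<^sup>2) / z ^ (3 - 1)) (at z)" .
    next
      show "P (- z) = - P z" for z by (simp add: P_def S(2))
    qed
    obtain K where K: "K \<ge> 0" "\<And>\<tau>. Im \<tau> \<ge> 1 \<Longrightarrow> norm (?g \<tau>) \<le> K / (Im \<tau>)\<^sup>2"
      by (rule q_series_decay[OF A], rule that) assumption+
    have ray: "(?e * of_real r)\<^sup>2 = \<i> * of_real (r\<^sup>2)" for r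
      unfolding power_mult_distrib cis_pi4_square by simp
    have "((\<lambda>R. 2 * ?g (\<tau> + (?e * of_real R)\<^sup>2) / (?e * of_real R)) \<longlongrightarrow> 0) at_top"
    proof (rule Lim_null_comparison)
      show "\<forall>\<^sub>F R in at_top. norm (2 * ?g (\<tau> + (?e * of_real R)\<^sup>2) / (?e * of_real R)) \<le> 2 * K / R"
        using eventually_ge_at_top[of 1]
      proof eventually_elim
        case (elim R)
        have im: "Im (\<tau> + (?e * of_real R)\<^sup>2) = Im \<tau> + R\<^sup>2" unfolding ray by simp
        have ge1: "Im \<tau> + R\<^sup>2 \<ge> 1" using \<tau> elim by (smt (verit) one_le_power)
        have "norm (?g (\<tau> + (?e * of_real R)\<^sup>2)) \<le> K / (Im \<tau> + R\<^sup>2)\<^sup>2"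
          using K(2)[of "\<tau> + (?e * of_real R)\<^sup>2"] ge1 unfolding im by simp
        also have "\<dots> \<le> K / 1" using K(1) ge1 by (intro divide_left_mono) auto
        finally have "norm (?g (\<tau> + (?e * of_real R)\<^sup>2)) \<le> K" by simp
        moreover have "norm (?e * of_real R) = R" using elim by (simp add: norm_mult)
        ultimately show ?case using elim unfolding norm_divide norm_mult[of 2]
          by (simp add: divide_right_mono)
      qed
      show "((\<lambda>R. 2 * K / R) \<longlongrightarrow> 0) at_top"
        by (intro tendsto_divide_0[OF tendsto_const] filterlim_at_top_imp_at_infinity filterlim_ident)
    qed
    from tendsto_diff[OF tendsto_mult_left[OF S3, of 4] this]
    show "((\<lambda>R. P (cis (pi/4) * of_real R)) \<longlongrightarrow> eichler_const 3 * q_series \<alpha> (\<lambda>n. of_real ((\<alpha> + real n) powr (1/2)) * A n) \<tau>) at_top"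
      unfolding P_def Q_def[symmetric] by (simp add: eichler_const_def mult_ac)
  qed
qed

lemma ex_odd_primitive:
  assumes "cuspidal_coeffs \<alpha> A" "Im \<tau> > 0" "N = 1 \<or> N = 3"
  obtains P where "odd_primitive N (q_series \<alpha> A) \<tau> P"
    "((\<lambda>R. P (cis (pi/4) * of_real R)) \<longlongrightarrow>
       eichler_const N * q_series \<alpha> (\<lambda>n. of_real ((\<alpha> + real n) powr (real N / 2 - 1)) * A n) \<tau>) at_top"
  using assms(3)
proof
  assume N: "N = 1"
  have e: "real N / 2 - 1 = -1/2" using N by simp
  show thesis
    by (rule odd_primitive_1[OF assms(1,2)], rule that) (simp_all only: e, simp_all only: N)
next
  assume N: "N = 3"
  have e: "real N / 2 - 1 = 1/2" using N by simp
  show thesis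
    by (rule odd_primitive_3[OF assms(1,2)], rule that) (simp_all only: e, simp_all only: N)
qed

text \<open>
The limit along the vertical ray above \<open>\<tau>\<close> is also the limit along any other vertical path
\<open>w\<close>: the two points at equal height are joined by a horizontal segment of bounded length on
which the derivative tends to 0 by the decay of \<open>g\<close>. The condition on \<open>Re\<close> selects which of the
two square roots of \<open>w - \<tau>\<close> the path \<open>z\<close> follows; the other one would give \<open>-l\<close>.
\<close>
lemma odd_primitive_tendsto:
  fixes F :: "'a filter"
  assumes P: "odd_primitive N g \<tau> P" and N: "N > 0"
    and decay: "\<And>w. Im w \<ge> 1 \<Longrightarrow> norm (g w) \<le> K / (Im w)\<^sup>2"
    and lim: "((\<lambda>R. P (cis (pi/4) * of_real R)) \<longlongrightarrow> l) at_top"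
    and sq: "\<forall>\<^sub>F t in F. (z t)\<^sup>2 = w t - \<tau>"
    and side: "\<forall>\<^sub>F t in F. Re (z t * cis (-(pi/4))) > 0"
    and Re_w: "\<forall>\<^sub>F t in F. Re (w t) = x"
    and Im_w: "filterlim (\<lambda>t. Im (w t)) at_top F"
  shows "((\<lambda>t. P (z t)) \<longlongrightarrow> l) F"
proof -
  let ?e = "cis (pi/4)"
  \<comment> \<open>The branch of the square root of w - \<tau> that is holomorphic above \<tau> and points along the ray.\<close>
  define b where "b = (\<lambda>w. ?e * csqrt (- \<i> * (w - \<tau>)))"
  define r where "r = (\<lambda>t. sqrt (Im (w t) - Im \<tau>))"
  define M where "M = max 1 (Im \<tau> + 1)"
  have K: "K \<ge> 0"
    using order.trans[OF norm_ge_zero decay[of \<i>]] by simp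
  have ee: "?e * cis (-(pi/4)) = 1" unfolding cis_mult right_minus by (rule cis_zero)
  have mi: "(cis (-(pi/4)))\<^sup>2 = -\<i>"
  proof -
    have "\<i> * (cis (-(pi/4)))\<^sup>2 = 1" unfolding cis_pi4_square[symmetric] power_mult_distrib[symmetric] ee by simp
    then have "-\<i> * (\<i> * (cis (-(pi/4)))\<^sup>2) = -\<i>" by simp
    then show ?thesis by simp
  qed
  have b_sq: "(b v)\<^sup>2 = v - \<tau>" for v
    unfolding b_def power_mult_distrib cis_pi4_square power2_csqrt by simp
  have z_eq: "z t = b (w t)" if "(z t)\<^sup>2 = w t - \<tau>" "Re (z t * cis (-(pi/4))) > 0" for t
  proof -
    have "(z t * cis (-(pi/4)))\<^sup>2 = - \<i> * (w t - \<tau>)" unfolding power_mult_distrib mi that(1) by simp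
    then have "csqrt (- \<i> * (w t - \<tau>)) = z t * cis (-(pi/4))" using that(2) by (intro csqrt_unique) auto
    then have "b (w t) = z t * (?e * cis (-(pi/4)))" unfolding b_def by (simp only: mult_ac)
    then show ?thesis unfolding ee by simp
  qed
  have der: "((\<lambda>v. P (b v)) has_field_derivative g v / b v ^ N) (at v)" if "Im v > Im \<tau>" "Im v > 0" for v
  proof -
    have "Re (- \<i> * (v - \<tau>)) > 0" using that by simp
    then have nn: "- \<i> * (v - \<tau>) \<notin> \<real>\<^sub>\<le>\<^sub>0" by (metis complex_nonpos_Reals_iff not_le)
    then have c0: "csqrt (- \<i> * (v - \<tau>)) \<noteq> 0" by auto
    have b0: "b v \<noteq> 0" using c0 unfolding b_def by simp
    have lin: "((\<lambda>u. - \<i> * (u - \<tau>)) has_field_derivative - \<i> * 1) (at v)"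
      by (auto intro!: derivative_eq_intros)
    have "(b has_field_derivative ?e * (inverse (2 * csqrt (- \<i> * (v - \<tau>))) * (- \<i> * 1))) (at v)"
      unfolding b_def
      by (rule DERIV_cmult[OF DERIV_chain2[where f = csqrt and g = "\<lambda>u. - \<i> * (u - \<tau>)",
            OF has_field_derivative_csqrt[OF nn] lin]])
    also have "?e * (inverse (2 * csqrt (- \<i> * (v - \<tau>))) * (- \<i> * 1)) = 1 / (2 * b v)"
    proof -
      define q where "q = csqrt (- \<i> * (v - \<tau>))"
      have q: "inverse (2 * q) * (2 * q) = 1" using c0 by (intro left_inverse) (simp add: q_def)
      have "?e * (inverse (2 * q) * (- \<i> * 1)) * (2 * (?e * q)) = (- \<i>) * ?e\<^sup>2 * (inverse (2 * q) * (2 * q))"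
        by (simp only: mult_ac mult_1_right mult_1_left power2_eq_square)
      also have "\<dots> = 1" unfolding q cis_pi4_square by simp
      finally show ?thesis using b0 unfolding q_def[symmetric] b_def by (intro eq_divide_imp) auto
    qed
    finally have b_der: "(b has_field_derivative 1 / (2 * b v)) (at v)" .
    have "Im (\<tau> + (b v)\<^sup>2) > 0" using that by (simp add: b_sq)
    from DERIV_chain2[where f = P and g = b, OF odd_primitiveD(1)[OF P b0 this] b_der]
    have "((\<lambda>v. P (b v)) has_field_derivative (2 * g (\<tau> + (b v)\<^sup>2) / b v ^ (N - 1)) * (1 / (2 * b v))) (at v)" .
    also have "(2 * g (\<tau> + (b v)\<^sup>2) / b v ^ (N - 1)) * (1 / (2 * b v)) = g v / b v ^ N"
    proof -
      have "b v ^ N = b v ^ (N - 1) * b v" using N by (metis power_minus_mult)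
      then show ?thesis by (simp add: b_sq)
    qed
    finally show ?thesis .
  qed
  have b_vert: "b (Complex (Re \<tau>) y) = ?e * of_real (sqrt (y - Im \<tau>))" if "y \<ge> Im \<tau>" for y
  proof -
    have "- \<i> * (Complex (Re \<tau>) y - \<tau>) = of_real (y - Im \<tau>)" by (simp add: complex_eq_iff)
    then show ?thesis unfolding b_def using that by (simp only: csqrt_of_real)
  qed
  have est: "norm (P (b v) - P (b (Complex (Re \<tau>) (Im v)))) \<le> K / (Im v)\<^sup>2 * \<bar>Re v - Re \<tau>\<bar>" if v: "Im v \<ge> M" for v
  proof -
    define S where "S = {u. Im u = Im v}"
    have S: "convex S" proof -
      have "S = {u. Im u \<ge> Im v} \<inter> {u. Im u \<le> Im v}" by (auto simp: S_def)
      then show ?thesis by (simp only: convex_Int convex_halfspace_Im_ge convex_halfspace_Im_le)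
    qed
    have "norm (P (b v) - P (b (Complex (Re \<tau>) (Im v)))) \<le> K / (Im v)\<^sup>2 * norm (v - Complex (Re \<tau>) (Im v))"
    proof (rule field_differentiable_bound[OF S, where f = "\<lambda>v. P (b v)" and f' = "\<lambda>v. g v / b v ^ N"])
      fix u assume u: "u \<in> S"
      then have im: "Im u = Im v" by (simp add: S_def)
      have big: "Im u \<ge> 1" "Im u \<ge> Im \<tau> + 1" using v im by (auto simp: M_def)
      show "((\<lambda>v. P (b v)) has_field_derivative g u / b u ^ N) (at u within S)"
        by (rule has_field_derivative_at_within, rule der) (use big in auto)
      have "1 \<le> \<bar>Im (u - \<tau>)\<bar>" using big by simp
      also have "\<dots> \<le> norm (u - \<tau>)" by (rule abs_Im_le_cmod)
      also have "\<dots> = (norm (b u))\<^sup>2" unfolding norm_power[symmetric] b_sq ..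
      finally have "norm (b u) \<ge> 1" by (metis norm_ge_zero one_power2 power2_le_imp_le)
      then have "norm (b u ^ N) \<ge> 1" by (simp add: norm_power)
      moreover from this have "0 < norm (b u ^ N) * 1" by linarith
      ultimately have "norm (g u) / norm (b u ^ N) \<le> norm (g u) / 1"
        by (intro divide_left_mono norm_ge_zero)
      then have "norm (g u / b u ^ N) \<le> norm (g u)" by (simp only: norm_divide div_by_1)
      also have "\<dots> \<le> K / (Im v)\<^sup>2" using decay[OF big(1)] im by simp
      finally show "norm (g u / b u ^ N) \<le> K / (Im v)\<^sup>2" .
    qed (auto simp: S_def)
    also have "norm (v - Complex (Re \<tau>) (Im v)) = \<bar>Re v - Re \<tau>\<bar>"
      by (simp add: cmod_def)
    finally show ?thesis .
  qed
  have big: "\<forall>\<^sub>F t in F. Im (w t) \<ge> M" using Im_w by (simp add: filterlim_at_top)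
  have "filterlim (\<lambda>t. - Im \<tau> + Im (w t)) at_top F"
    by (rule filterlim_tendsto_add_at_top[OF tendsto_const Im_w])
  then have "filterlim (\<lambda>t. Im (w t) - Im \<tau>) at_top F" by simp
  then have "filterlim r at_top F"
    unfolding r_def by (rule filterlim_compose[OF sqrt_at_top])
  then have "((\<lambda>t. P (?e * of_real (r t))) \<longlongrightarrow> l) F"
    by (rule filterlim_compose[OF lim])
  moreover have "((\<lambda>t. P (?e * of_real (r t)) - P (z t)) \<longlongrightarrow> 0) F"
  proof (rule Lim_null_comparison)
    show "\<forall>\<^sub>F t in F. norm (P (?e * of_real (r t)) - P (z t)) \<le> K * \<bar>x - Re \<tau>\<bar> / Im (w t)"
      using big sq side Re_w
    proof eventually_elim
      case (elim t)
      have 1: "Im (w t) \<ge> 1" "Im (w t) \<ge> Im \<tau>" using elim(1) by (auto simp: M_def)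
      have "norm (P (z t) - P (?e * of_real (r t))) \<le> K / (Im (w t))\<^sup>2 * \<bar>x - Re \<tau>\<bar>"
        using est[OF elim(1)] unfolding z_eq[OF elim(2,3)] b_vert[OF 1(2)] r_def elim(4) .
      also have "\<dots> \<le> K / Im (w t) * \<bar>x - Re \<tau>\<bar>"
      proof (intro mult_right_mono divide_left_mono)
        show "Im (w t) \<le> (Im (w t))\<^sup>2" using 1(1) by (simp add: self_le_power)
      qed (use 1 K in auto)
      finally show ?case by (simp add: norm_minus_commute)
    qed
    show "((\<lambda>t. K * \<bar>x - Re \<tau>\<bar> / Im (w t)) \<longlongrightarrow> 0) F"
      by (intro tendsto_divide_0[OF tendsto_const] filterlim_at_top_imp_at_infinity Im_w)
  qed
  ultimately have "((\<lambda>t. P (?e * of_real (r t)) - (P (?e * of_real (r t)) - P (z t))) \<longlongrightarrow> l - 0) F"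
    by (rule tendsto_diff)
  then show ?thesis by simp
qed

section \<open>Transformation of odd primitives\<close>

lemma csqrt_affine_nonzero:
  fixes c d :: int
  assumes "c \<noteq> 0" "Im w > 0"
  shows "of_int c * w + of_int d \<notin> \<real>\<^sub>\<le>\<^sub>0"
  using assms by (auto simp: complex_nonpos_Reals_iff)

lemma moebius_diff:
  fixes a b c d w v :: complex
  assumes "a * d - b * c = 1" "c * w + d \<noteq> 0" "c * v + d \<noteq> 0"
  shows "moebius a b c d w - moebius a b c d v = (w - v) / ((c * w + d) * (c * v + d))"
proof -
  have "(a * w + b) * (c * v + d) - (a * v + b) * (c * w + d) = (a * d - b * c) * (w - v)"
    by (simp add: algebra_simps)
  then show ?thesis using assms unfolding moebius_def
    by (simp add: diff_frac_eq)
qed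

text \<open>
For \<open>w = \<tau> + z^2\<close> the substitution \<open>\<zeta> = z / (s(w) s(\<tau>))\<close> satisfies
\<open>\<zeta>^2 = \<gamma> w - \<gamma> \<tau>\<close>, so it lifts \<open>\<gamma>\<close> to the double covers of the half-plane branched at \<open>\<tau>\<close>
and at \<open>\<gamma> \<tau>\<close>. Both sides are odd primitives of the same form on the connected punctured cover:
the powers of \<open>s(w)\<close> from the weight, from the kernel and from \<open>d\<zeta> = (s(\<tau>) / s(w)^3) dz\<close>
cancel. Hence they differ by a constant, and that constant is 0 by oddness.
\<close>
lemma odd_primitive_transform:
  fixes g :: "'r::finite \<Rightarrow> complex \<Rightarrow> complex" and a b c d :: int and R :: "'r \<Rightarrow> complex"
  defines "s \<equiv> \<lambda>w::complex. csqrt (of_int c * w + of_int d)"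
    and "\<gamma> \<equiv> moebius (of_int a) (of_int b) (of_int c) (of_int d)"
  assumes det: "a * d - b * c = 1" and c: "c \<noteq> 0" and N: "N = 1 \<or> N = 3" and \<tau>: "Im \<tau> > 0"
    and pos: "\<And>w. Im w > 0 \<Longrightarrow> Im (\<gamma> w) > 0"
    and law: "\<And>w. Im w > 0 \<Longrightarrow> g' (\<gamma> w) = s w ^ (4 - N) * (\<Sum>j\<in>UNIV. R j * g j w)"
    and P: "\<And>j. odd_primitive N (g j) \<tau> (P j)" and P': "odd_primitive N g' (\<gamma> \<tau>) P'"
    and z: "z \<noteq> 0" "Im (\<tau> + z\<^sup>2) > 0"
  shows "P' (z / (s (\<tau> + z\<^sup>2) * s \<tau>)) = s \<tau> ^ N * (\<Sum>j\<in>UNIV. R j * P j z)"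
proof -
  define \<Omega> where "\<Omega> = {z. Im (\<tau> + z\<^sup>2) > 0}"
  define \<zeta> where "\<zeta> = (\<lambda>z. z / (s (\<tau> + z\<^sup>2) * s \<tau>))"
  define D where "D = (\<lambda>z. P' (\<zeta> z) - s \<tau> ^ N * (\<Sum>j\<in>UNIV. R j * P j z))"
  have "open \<Omega>" "starlike \<Omega>" using shifted_square_domain[OF \<tau>] by (simp_all add: \<Omega>_def)
  then have conn: "connected (\<Omega> - {0})"
    by (intro connected_open_delete starlike_imp_connected) auto
  have op: "open (\<Omega> - {0})" using \<open>open \<Omega>\<close> by (intro open_Diff) auto
  have s2: "(s w)\<^sup>2 = of_int c * w + of_int d" for w by (simp add: s_def)
  have s0: "s w \<noteq> 0" if "Im w > 0" for w
    using csqrt_affine_nonzero[OF c that, of d] by (auto simp: s_def)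
  have der0: "(D has_field_derivative 0) (at x)" if x: "x \<in> \<Omega> - {0}" for x
  proof -
    define w where "w = \<tau> + x\<^sup>2"
    have w: "Im w > 0" "x \<noteq> 0" using x by (auto simp: \<Omega>_def w_def)
    define S T where "S = s w" and "T = s \<tau>"
    have ST: "S \<noteq> 0" "T \<noteq> 0" using s0 w \<tau> by (auto simp: S_def T_def)
    have S2: "S\<^sup>2 = of_int c * w + of_int d" and T2: "T\<^sup>2 = of_int c * \<tau> + of_int d"
      using s2 by (auto simp: S_def T_def)
    have nn: "of_int c * (\<tau> + x\<^sup>2) + of_int d \<notin> \<real>\<^sub>\<le>\<^sub>0"
      using csqrt_affine_nonzero[OF c w(1), of d] by (simp add: w_def)
    have lin: "((\<lambda>x. of_int c * (\<tau> + x\<^sup>2) + of_int d) has_field_derivative of_int c * (2 * x)) (at x)"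
      by (auto intro!: derivative_eq_intros)
    have ds: "((\<lambda>x. s (\<tau> + x\<^sup>2)) has_field_derivative inverse (2 * S) * (of_int c * (2 * x))) (at x)"
      unfolding S_def w_def s_def
      by (rule DERIV_chain2[where f = csqrt and g = "\<lambda>x. of_int c * (\<tau> + x\<^sup>2) + of_int d",
            OF has_field_derivative_csqrt[OF nn] lin])
    have "S * T \<noteq> 0" using ST by simp
    then have "s (\<tau> + x\<^sup>2) * s \<tau> \<noteq> 0" by (simp add: S_def T_def w_def)
    from DERIV_divide[OF DERIV_ident DERIV_cmult_right[OF ds, of "s \<tau>"] this]
    have "(\<zeta> has_field_derivative (1 * (S * T) - x * (inverse (2 * S) * (of_int c * (2 * x)) * T)) / (S * T * (S * T))) (at x)"
      unfolding \<zeta>_def S_def T_def w_def .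
    also have "(1 * (S * T) - x * (inverse (2 * S) * (of_int c * (2 * x)) * T)) / (S * T * (S * T)) = T / S ^ 3"
    proof -
      have e: "S\<^sup>2 - of_int c * x\<^sup>2 = T\<^sup>2" unfolding S2 T2 by (simp add: w_def algebra_simps)
      have "1 * (S * T) - x * (inverse (2 * S) * (of_int c * (2 * x)) * T) = T / S * (S\<^sup>2 - of_int c * x\<^sup>2)"
        using ST by (simp add: field_simps power2_eq_square)
      also have "\<dots> = T / S * T\<^sup>2" unfolding e ..
      finally show ?thesis using ST by (simp add: power2_eq_square power3_eq_cube)
    qed
    finally have d\<zeta>: "(\<zeta> has_field_derivative T / S ^ 3) (at x)" .
    have \<zeta>x: "\<zeta> x = x / (S * T)" by (simp add: \<zeta>_def S_def T_def w_def)
    have \<zeta>0: "\<zeta> x \<noteq> 0" using ST w by (simp add: \<zeta>x)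
    have \<gamma>w: "\<gamma> \<tau> + (\<zeta> x)\<^sup>2 = \<gamma> w"
    proof -
      have "of_int a * of_int d - of_int b * of_int c = (1 :: complex)"
        using det by (metis of_int_1 of_int_diff of_int_mult)
      moreover have "of_int c * w + of_int d \<noteq> (0::complex)" "of_int c * \<tau> + of_int d \<noteq> (0::complex)"
        unfolding S2[symmetric] T2[symmetric] using ST by simp_all
      ultimately have "\<gamma> w - \<gamma> \<tau> = (w - \<tau>) / (S\<^sup>2 * T\<^sup>2)"
        unfolding \<gamma>_def S2 T2 by (rule moebius_diff)
      also have "\<dots> = (\<zeta> x)\<^sup>2" unfolding \<zeta>x by (simp add: w_def power_divide power_mult_distrib)
      finally show ?thesis by (simp add: algebra_simps)
    qed
    have "Im (\<gamma> \<tau> + (\<zeta> x)\<^sup>2) > 0" unfolding \<gamma>w using w by (intro pos)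
    from DERIV_chain2[where f = P' and g = \<zeta>, OF odd_primitiveD(1)[OF P' \<zeta>0 this] d\<zeta>]
    have "((\<lambda>x. P' (\<zeta> x)) has_field_derivative (2 * g' (\<gamma> w) / \<zeta> x ^ (N - 1)) * (T / S ^ 3)) (at x)"
      unfolding \<gamma>w .
    also have "(2 * g' (\<gamma> w) / \<zeta> x ^ (N - 1)) * (T / S ^ 3) = T ^ N * (\<Sum>j\<in>UNIV. R j * (2 * g j w / x ^ (N - 1)))"
    proof -
      define G where "G = (\<Sum>j\<in>UNIV. R j * g j w)"
      have "(2 * g' (\<gamma> w) / \<zeta> x ^ (N - 1)) * (T / S ^ 3) = T ^ N * (2 * G / x ^ (N - 1))"
        unfolding law[OF w(1)] G_def[symmetric] \<zeta>x S_def[symmetric]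
        using N ST w(2) by (auto simp: field_simps power2_eq_square power3_eq_cube)
      also have "2 * G / x ^ (N - 1) = (\<Sum>j\<in>UNIV. R j * (2 * g j w / x ^ (N - 1)))"
        unfolding G_def sum_distrib_left sum_divide_distrib by (intro sum.cong) auto
      finally show ?thesis .
    qed
    finally have 1: "((\<lambda>x. P' (\<zeta> x)) has_field_derivative T ^ N * (\<Sum>j\<in>UNIV. R j * (2 * g j w / x ^ (N - 1)))) (at x)" .
    have Pj: "(P j has_field_derivative 2 * g j w / x ^ (N - 1)) (at x)" for j
      unfolding w_def by (rule odd_primitiveD(1)[OF P]) (use w in \<open>auto simp: w_def\<close>)
    have "((\<lambda>x. s \<tau> ^ N * (\<Sum>j\<in>UNIV. R j * P j x)) has_field_derivative T ^ N * (\<Sum>j\<in>UNIV. R j * (2 * g j w / x ^ (N - 1)))) (at x)"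
      unfolding T_def by (intro DERIV_cmult DERIV_sum Pj)
    from DERIV_diff[OF 1 this] show ?thesis unfolding D_def by simp
  qed
  obtain C where C: "\<And>x. x \<in> \<Omega> - {0} \<Longrightarrow> D x = C"
  proof (rule DERIV_zero_connected_constant[OF conn op finite.emptyI])
    show "continuous_on (\<Omega> - {0}) D"
      using der0 by (meson DERIV_isCont continuous_at_imp_continuous_on)
    show "\<forall>x\<in>\<Omega> - {0} - {}. (D has_field_derivative 0) (at x)" using der0 by simp
  qed (use that in blast)
  have odd: "D (- z) = - D z"
  proof -
    have "\<zeta> (- z) = - \<zeta> z" by (simp add: \<zeta>_def)
    then show ?thesis unfolding D_def by (simp add: odd_primitiveD(2)[OF P'] odd_primitiveD(2)[OF P] sum_negf)
  qed
  have "D z = C" "D (- z) = C" using z by (auto intro!: C simp: \<Omega>_def)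
  with odd have "D z = 0" by simp
  then show ?thesis unfolding D_def \<zeta>_def by simp
qed

section \<open>Integrals of the kernel along a line\<close>

text \<open>
Here and below \<open>u\<close> stands for \<open>c \<tau> + d\<close>. The excluded set is the closed quadrant that the cut
of the square root sweeps out when its branch point moves along \<open>i c t\<close>, \<open>t \<ge> 0\<close>.
\<close>
lemma slit_shift:
  fixes c t :: real
  assumes "Re u > 0 \<or> c * Im u < 0" "t \<ge> 0" "c \<noteq> 0"
  shows "u - \<i> * of_real (c * t) \<notin> \<real>\<^sub>\<le>\<^sub>0"
proof (cases "Re u > 0")
  case True
  then show ?thesis by (simp add: complex_nonpos_Reals_iff)
next
  case False
  then have "c * Im u < 0" using assms by simp
  moreover have "c * (c * t) \<ge> 0" using assms(2) by (simp add: mult.assoc [symmetric])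
  ultimately have "c * (Im u - c * t) < 0" by (simp add: right_diff_distrib)
  then have "Im u - c * t \<noteq> 0" by auto
  then show ?thesis by (simp add: complex_nonpos_Reals_iff)
qed

lemma slit_shift_dist:
  fixes c t :: real
  assumes "Re u \<ge> \<delta> \<or> c * Im u \<le> - \<bar>c\<bar> * \<delta>" "t \<ge> 0" "c \<noteq> 0" "\<delta> > 0"
  shows "\<delta> \<le> norm (u - \<i> * of_real (c * t))"
proof (cases "Re u \<ge> \<delta>")
  case True
  then show ?thesis using abs_Re_le_cmod[of "u - \<i> * of_real (c * t)"] by simp
next
  case False
  then have "c * Im u \<le> - \<bar>c\<bar> * \<delta>" using assms by simp
  moreover have "c * (c * t) \<ge> 0" using assms(2) by (simp add: mult.assoc [symmetric])
  ultimately have "\<bar>c\<bar> * \<delta> \<le> - (c * (Im u - c * t))" unfolding right_diff_distrib by linarith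
  also have "\<dots> \<le> \<bar>c\<bar> * \<bar>Im u - c * t\<bar>" unfolding abs_mult[symmetric] by (rule abs_ge_minus_self)
  finally have "\<delta> \<le> \<bar>Im u - c * t\<bar>" using assms(3) by simp
  then show ?thesis using abs_Im_le_cmod[of "u - \<i> * of_real (c * t)"] by simp
qed

lemma continuous_on_csqrt_shift:
  fixes c :: real
  assumes "\<And>u. u \<in> S \<Longrightarrow> Re u > 0 \<or> c * Im u < 0" "c \<noteq> 0" "T \<subseteq> {0..}"
  shows "continuous_on (S \<times> T) (\<lambda>(u, t). csqrt (u - \<i> * of_real (c * t)))"
proof -
  have "continuous_on (S \<times> T) (csqrt \<circ> (\<lambda>p. fst p - \<i> * of_real (c * snd p)))"
  proof (rule continuous_on_compose)
    show "continuous_on (S \<times> T) (\<lambda>p. fst p - \<i> * of_real (c * snd p))"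
      by (intro continuous_intros)
    show "continuous_on ((\<lambda>p. fst p - \<i> * of_real (c * snd p)) ` (S \<times> T)) csqrt"
    proof (rule continuous_at_imp_continuous_on, rule ballI)
      fix z assume "z \<in> (\<lambda>p. fst p - \<i> * of_real (c * snd p)) ` (S \<times> T)"
      then obtain u t where ut: "u \<in> S" "t \<in> T" and z: "z = u - \<i> * of_real (c * t)" by auto
      have "z \<notin> \<real>\<^sub>\<le>\<^sub>0" unfolding z using ut assms by (intro slit_shift) auto
      then show "isCont csqrt z" by (rule continuous_at_csqrt)
    qed
  qed
  then show ?thesis by (simp add: o_def case_prod_unfold)
qed

lemma kernel_integral_holomorphic_convex:
  fixes \<phi> :: "real \<Rightarrow> complex" and c :: real
  assumes c: "c \<noteq> 0" and cont: "continuous_on {0..} \<phi>"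
    and S: "convex S" "open S" "\<And>u. u \<in> S \<Longrightarrow> Re u > 0 \<or> c * Im u < 0"
  shows "(\<lambda>u. integral {0..real n} (\<lambda>t. \<phi> t / csqrt (u - \<i> * of_real (c * t)) ^ N)) holomorphic_on S"
proof -
  let ?q = "\<lambda>u t. csqrt (u - \<i> * of_real (c * t))"
  have q0: "?q u t \<noteq> 0" if "u \<in> S" "t \<in> {0..}" for u t
    using slit_shift[of u c t] S(3)[OF that(1)] that(2) c by auto
  have qcont: "continuous_on (S \<times> {0..}) (\<lambda>(u, t). ?q u t)"
    by (rule continuous_on_csqrt_shift[OF S(3) c]) auto
  have "(\<lambda>u. integral (cbox 0 (real n)) (\<lambda>t. \<phi> t / ?q u t ^ N)) holomorphic_on S"
  proof (rule leibniz_rule_holomorphic)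
    fix u t assume u: "u \<in> S" and "t \<in> cbox 0 (real n)"
    then have t: "t \<ge> 0" by simp
    have nn: "u - \<i> * of_real (c * t) \<notin> \<real>\<^sub>\<le>\<^sub>0" using slit_shift[OF S(3)[OF u] t c] .
    have lin: "((\<lambda>u. u - \<i> * of_real (c * t)) has_field_derivative 1) (at u within S)"
      by (auto intro!: derivative_eq_intros)
    have 1: "((\<lambda>u. ?q u t) has_field_derivative inverse (2 * ?q u t) * 1) (at u within S)"
      by (rule DERIV_chain2[where f = csqrt and g = "\<lambda>u. u - \<i> * of_real (c * t)", OF has_field_derivative_csqrt[OF nn] lin])
    have q: "?q u t \<noteq> 0" using q0[OF u] t by simp
    show "((\<lambda>u. \<phi> t / ?q u t ^ N) has_field_derivative
        (0 * ?q u t ^ N - \<phi> t * (of_nat N * (inverse (2 * ?q u t) * 1 * ?q u t ^ (N - Suc 0)))) / (?q u t ^ N * ?q u t ^ N)) (at u within S)"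
      by (rule DERIV_divide[OF DERIV_const DERIV_power[OF 1]]) (use q in simp)
  next
    fix u assume u: "u \<in> S"
    have "continuous_on (cbox 0 (real n)) ((\<lambda>(u, t). ?q u t) \<circ> (\<lambda>t. (u, t)))"
      by (rule continuous_on_compose[OF _ continuous_on_subset[OF qcont]])
         (use u in \<open>auto intro!: continuous_intros\<close>)
    then have "continuous_on (cbox 0 (real n)) (\<lambda>t. ?q u t)" by (simp add: o_def)
    then show "(\<lambda>t. \<phi> t / ?q u t ^ N) integrable_on cbox 0 (real n)"
      using q0[OF u] by (intro integrable_continuous continuous_intros continuous_on_subset[OF cont]) auto
  next
    have *: "continuous_on (S \<times> cbox 0 (real n)) (\<lambda>p. \<phi> (snd p))"
      by (rule continuous_on_compose2[OF cont]) (auto intro!: continuous_intros)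
    have **: "continuous_on (S \<times> cbox 0 (real n)) (\<lambda>p. ?q (fst p) (snd p))"
    proof -
      have "S \<times> cbox 0 (real n) \<subseteq> S \<times> {0..}" by auto
      from continuous_on_subset[OF qcont this] show ?thesis by (simp only: case_prod_unfold)
    qed
    show "continuous_on (S \<times> cbox 0 (real n)) (\<lambda>(u, t). (0 * ?q u t ^ N - \<phi> t * (of_nat N * (inverse (2 * ?q u t) * 1 * ?q u t ^ (N - Suc 0)))) / (?q u t ^ N * ?q u t ^ N))"
      unfolding case_prod_unfold
    proof (intro continuous_intros * **)
      show "\<forall>p\<in>S \<times> cbox 0 (real n). 2 * ?q (fst p) (snd p) \<noteq> 0"
        "\<forall>p\<in>S \<times> cbox 0 (real n). ?q (fst p) (snd p) ^ N * ?q (fst p) (snd p) ^ N \<noteq> 0"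
        using q0 by (auto simp del: csqrt_eq_0)
    qed
  qed (rule S(1))
  then show ?thesis by (simp add: cbox_interval)
qed

text \<open>
Away from the line of branch points the kernel is bounded locally uniformly in \<open>u\<close>, so the
decay of \<open>\<phi>\<close> gives a locally uniform limit of the holomorphic integrals over \<open>{0..n}\<close>.
\<close>
lemma kernel_integral_holomorphic:
  fixes \<phi> :: "real \<Rightarrow> complex" and c :: real
  assumes c: "c \<noteq> 0" and cont: "continuous_on {0..} \<phi>"
    and decay: "\<And>t. t \<ge> 0 \<Longrightarrow> norm (\<phi> t) \<le> K / (1 + t)\<^sup>2"
  obtains G where "G holomorphic_on {u. Re u > 0 \<or> c * Im u < 0}"
    "\<And>u. Re u > 0 \<or> c * Im u < 0 \<Longrightarrow>
       (\<lambda>n. integral {0..real n} (\<lambda>t. \<phi> t / csqrt (u - \<i> * of_real (c * t)) ^ N)) \<longlonglongrightarrow> G u"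
proof -
  let ?q = "\<lambda>u t. csqrt (u - \<i> * of_real (c * t))"
  define I where "I = (\<lambda>n u. integral {0..real n} (\<lambda>t. \<phi> t / ?q u t ^ N))"
  define W where "W = {u. Re u > 0 \<or> c * Im u < 0}"
  define W1 where "W1 = {u. Re u > 0}"
  define W2 where "W2 = {u. c * Im u < 0}"
  have W: "W = W1 \<union> W2" by (auto simp: W_def W1_def W2_def)
  have o1: "open W1" "convex W1"
    unfolding W1_def by (auto intro: open_halfspace_Re_gt convex_halfspace_Re_gt)
  have o2: "open W2" "convex W2"
  proof -
    have "W2 = (if c > 0 then {u. Im u < 0} else {u. Im u > 0})"
      using c by (auto simp: W2_def mult_less_0_iff)
    then show "open W2" "convex W2"
      by (auto intro: open_halfspace_Im_lt convex_halfspace_Im_lt open_halfspace_Im_gt convex_halfspace_Im_gt)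
  qed
  have hol: "I n holomorphic_on W" for n
    unfolding W I_def
    by (intro holomorphic_on_Un kernel_integral_holomorphic_convex c cont o1 o2) (auto simp: W1_def W2_def)
  have K: "K \<ge> 0" using order.trans[OF norm_ge_zero decay[of 0]] by simp
  have openW: "open W" unfolding W using o1 o2 by auto
  have unif: "\<exists>d>0. cball u d \<subseteq> W \<and> uniformly_convergent_on (cball u d) I" if u: "u \<in> W" for u
  proof -
    \<comment> \<open>A margin by which a whole neighbourhood of u stays away from the branch points.\<close>
    obtain \<delta> where \<delta>: "\<delta> > 0" "Re u > \<delta> \<or> c * Im u < - \<bar>c\<bar> * \<delta>"
    proof (cases "Re u > 0")
      case True then show thesis using that[of "Re u / 2"] by simp
    next
      case False
      then have neg: "c * Im u < 0" using u by (simp add: W_def)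
      define \<delta> where "\<delta> = - (c * Im u) / (2 * \<bar>c\<bar>)"
      have "\<delta> > 0" unfolding \<delta>_def using neg c by (intro divide_pos_pos) auto
      moreover have "\<bar>c\<bar> * \<delta> = - (c * Im u) / 2" using c by (simp add: \<delta>_def)
      ultimately show thesis using that[of \<delta>] neg by simp
    qed
    define V where "V = {v. Re v > \<delta> \<or> c * Im v < - \<bar>c\<bar> * \<delta>}"
    have "open V" unfolding V_def by (intro open_Collect_disj open_Collect_less continuous_intros)
    moreover have "u \<in> V" using \<delta>(2) by (simp add: V_def)
    ultimately obtain d where d: "d > 0" "cball u d \<subseteq> V" using open_contains_cball_eq by blast
    have "\<bar>c\<bar> * \<delta> > 0" using \<delta>(1) c by simp
    then have VW: "V \<subseteq> W" using \<delta>(1) by (auto simp: V_def W_def)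
    define K' where "K' = K / sqrt \<delta> ^ N"
    have bound: "norm (\<phi> t / ?q v t ^ N) \<le> K' / (1 + t)\<^sup>2" if "v \<in> cball u d" "t \<ge> 0" for v t
    proof -
      have "v \<in> V" using that d by auto
      then have "\<delta> \<le> norm (v - \<i> * of_real (c * t))"
        by (intro slit_shift_dist[OF _ that(2) c \<delta>(1)]) (auto simp: V_def)
      then have le: "sqrt \<delta> ^ N \<le> norm (?q v t ^ N)"
        unfolding norm_power norm_csqrt using \<delta>(1) by (intro power_mono) auto
      have pos: "0 < sqrt \<delta> ^ N" using \<delta>(1) by simp
      have "norm (\<phi> t / ?q v t ^ N) = norm (\<phi> t) / norm (?q v t ^ N)" by (rule norm_divide)
      also have "\<dots> \<le> (K / (1 + t)\<^sup>2) / sqrt \<delta> ^ N"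
        by (rule frac_le[OF _ decay[OF that(2)] pos le]) (use K in simp)
      also have "\<dots> = K' / (1 + t)\<^sup>2" by (simp add: K'_def)
      finally show ?thesis .
    qed
    have "uniformly_convergent_on (cball u d) (\<lambda>b v. integral {0..real b} (\<lambda>t. \<phi> t / ?q v t ^ N))"
    proof (rule uniformly_convergent_improper_integral[where g = "\<lambda>t. K' / (1 + t)\<^sup>2" and G = "\<lambda>t. - K' / (1 + t)"])
      fix t :: real assume t: "t \<ge> 0"
      then have "1 + t \<noteq> 0" by simp
      then show "((\<lambda>t. - K' / (1 + t)) has_field_derivative K' / (1 + t)\<^sup>2) (at t within {0..})"
        by (auto intro!: derivative_eq_intros simp: power2_eq_square)
    next
      fix a b :: real and v assume v: "v \<in> cball u d" and ab: "a \<ge> 0" "a \<le> b"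
      have vW: "v \<in> W" using v d VW by auto
      have q0: "?q v t \<noteq> 0" if "t \<ge> 0" for t
        using slit_shift[of v c t] vW that c by (auto simp: W_def)
      have "continuous_on {a..b} ((\<lambda>(u, t). ?q u t) \<circ> (\<lambda>t. (v, t)))"
      proof (rule continuous_on_compose)
        show "continuous_on ((\<lambda>t. (v, t)) ` {a..b}) (\<lambda>(u, t). ?q u t)"
          by (rule continuous_on_subset[OF continuous_on_csqrt_shift[of W c "{0..}"]])
             (use vW ab c in \<open>auto simp: W_def\<close>)
      qed (auto intro!: continuous_intros)
      then have "continuous_on {a..b} (\<lambda>t. ?q v t)" by (simp add: o_def)
      then show "(\<lambda>t. \<phi> t / ?q v t ^ N) integrable_on {a..b}"
        using q0 ab by (intro integrable_continuous_interval continuous_intros continuous_on_subset[OF cont]) auto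
    next
      have "((\<lambda>n. - K' / (1 + real n)) \<longlongrightarrow> 0) sequentially"
        by real_asymp
      then show "convergent (\<lambda>x. - K' / (1 + real x))" by (auto simp: convergent_def)
    next
      show "norm (\<phi> t / ?q v t ^ N) \<le> K' / (1 + t)\<^sup>2" if "v \<in> cball u d" "t \<ge> 0" for v t
        using bound[OF that] .
    qed
    then show ?thesis using d VW unfolding I_def by blast
  qed
  define G where "G = (\<lambda>u. lim (\<lambda>n. I n u))"
  show thesis
  proof (rule that[of G])
    have "G holomorphic_on W"
    proof (rule holomorphic_uniform_sequence[OF openW hol])
      fix u assume "u \<in> W"
      from unif[OF this] show "\<exists>d>0. cball u d \<subseteq> W \<and> uniform_limit (cball u d) I G sequentially"
        by (auto simp: uniformly_convergent_uniform_limit_iff G_def)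
    qed
    then show "G holomorphic_on {u. Re u > 0 \<or> c * Im u < 0}" by (simp add: W_def)
    fix u assume "Re u > 0 \<or> c * Im u < 0"
    then have "u \<in> W" by (simp add: W_def)
    from unif[OF this] obtain d where "d > 0" "uniformly_convergent_on (cball u d) I" by auto
    then have "convergent (\<lambda>n. I n u)"
      by (intro uniformly_convergent_imp_convergent[of "cball u d"]) auto
    then show "(\<lambda>n. integral {0..real n} (\<lambda>t. \<phi> t / ?q u t ^ N)) \<longlonglongrightarrow> G u"
      unfolding G_def convergent_LIMSEQ_iff by (simp add: I_def)
  qed
qed

section \<open>The period integral between two cusps\<close>

lemma csqrt_quadrant_le:
  assumes "Re v \<ge> 0"
  shows "\<bar>Im (csqrt v)\<bar> \<le> Re (csqrt v)"
proof -
  define q where "q = csqrt v"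
  have "Re v = (Re q)\<^sup>2 - (Im q)\<^sup>2" unfolding q_def by (metis Re_power2 power2_csqrt)
  then have "(Im q)\<^sup>2 \<le> (Re q)\<^sup>2" using assms by linarith
  then have "\<bar>Im q\<bar> \<le> \<bar>Re q\<bar>" by (simp only: abs_le_square_iff)
  moreover have "Re q \<ge> 0" unfolding q_def by (rule Re_csqrt)
  ultimately show ?thesis unfolding q_def[symmetric] by linarith
qed

lemma csqrt_quadrant_less:
  assumes "Re v > 0"
  shows "\<bar>Im (csqrt v)\<bar> < Re (csqrt v)"
proof -
  define q where "q = csqrt v"
  have "Re v = (Re q)\<^sup>2 - (Im q)\<^sup>2" unfolding q_def by (metis Re_power2 power2_csqrt)
  then have "\<bar>Im q\<bar>\<^sup>2 < \<bar>Re q\<bar>\<^sup>2" unfolding power2_abs using assms by linarith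
  then have "\<bar>Im q\<bar> < \<bar>Re q\<bar>" by (rule power2_less_imp_less) simp
  moreover have "Re q \<ge> 0" unfolding q_def by (rule Re_csqrt)
  ultimately show ?thesis unfolding q_def[symmetric] by linarith
qed

lemma Re_mult_pos:
  assumes "\<bar>Im x\<bar> \<le> Re x" "x \<noteq> 0" "\<bar>Im y\<bar> < Re y"
  shows "Re (x * y) > 0"
proof -
  have "Re x \<noteq> 0" using assms(1,2) by (auto simp: complex_eq_iff)
  then have "Re x > 0" using assms(1) by linarith
  have "\<bar>Im x * Im y\<bar> \<le> Re x * \<bar>Im y\<bar>" unfolding abs_mult using assms(1) by (rule mult_right_mono) simp
  also have "\<dots> < Re x * Re y" using assms(3) \<open>Re x > 0\<close> by simp
  finally show ?thesis by simp
qed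

lemma Re_divide_pos:
  assumes "\<bar>Im x\<bar> \<le> Re x" "x \<noteq> 0" "\<bar>Im y\<bar> < Re y"
  shows "Re (x / y) > 0"
proof -
  have "Re (x * cnj y) > 0" using assms by (intro Re_mult_pos) auto
  moreover have "y \<noteq> 0" using assms(3) by auto
  ultimately show ?thesis
    by (subst complex_div_cnj) (simp only: of_real_power [symmetric] Re_divide_of_real zero_less_divide_iff, simp)
qed

lemma Im_moebius:
  fixes a b c d :: real
  shows "Im (moebius (of_real a) (of_real b) (of_real c) (of_real d) w) =
     (a * d - b * c) * Im w / (norm (of_real c * w + of_real d))\<^sup>2"
proof -
  have "Im ((of_real a * w + of_real b) * cnj (of_real c * w + of_real d)) = (a * d - b * c) * Im w"
    by (simp add: algebra_simps)
  then show ?thesis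
    unfolding moebius_def by (subst complex_div_cnj) (simp only: of_real_power [symmetric] Im_divide_of_real)
qed

text \<open>
The vector \<open>g\<close> together with one matrix whose lower left entry \<open>c\<close> is nonzero. The parameters
\<open>R\<close> and \<open>Rinv\<close> are the values of the multiplier at this matrix and their inverse, and \<open>s w\<close> is
the square root of \<open>c w + d\<close>. For \<open>c \<noteq> 0\<close> the number \<open>c w + d\<close> never meets the cut, so all half-integral
powers of it are powers of the single holomorphic function \<open>s\<close>: the weight \<open>\<kappa>\<close> contributes
\<open>s^(4 - N)\<close> and the weight \<open>2 - \<kappa>\<close> contributes \<open>s^N\<close>.
\<close>
locale cuspidal_vector =
  fixes N :: nat and \<alpha> :: "'r::finite \<Rightarrow> real" and A :: "'r \<Rightarrow> nat \<Rightarrow> complex"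
    and a b c d :: int and R Rinv :: "'r \<Rightarrow> 'r \<Rightarrow> complex"
    and s \<gamma> :: "complex \<Rightarrow> complex" and g EI :: "'r \<Rightarrow> complex \<Rightarrow> complex"
  defines "s \<equiv> \<lambda>w. csqrt (of_int c * w + of_int d)"
    and "\<gamma> \<equiv> moebius (of_int a) (of_int b) (of_int c) (of_int d)"
    and "g \<equiv> \<lambda>k. q_series (\<alpha> k) (A k)"
    and "EI \<equiv> \<lambda>k. q_series (\<alpha> k) (\<lambda>n. of_real ((\<alpha> k + real n) powr (real N / 2 - 1)) * A k n)"
  assumes N: "N = 1 \<or> N = 3"
    and coeffs: "\<And>k. cuspidal_coeffs (\<alpha> k) (A k)"
    and det: "a * d - b * c = 1" and c: "c \<noteq> 0"
    and inverse: "\<And>k i. (\<Sum>j\<in>UNIV. Rinv k j * R j i) = (if i = k then 1 else 0)"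
    and law: "\<And>w k. Im w > 0 \<Longrightarrow> g k (\<gamma> w) = s w ^ (4 - N) * (\<Sum>j\<in>UNIV. R k j * g j w)"
begin

text \<open>
The vertical line through the cusp \<open>-d/c\<close>, which \<open>\<gamma>\<close> maps to the vertical line through
\<open>a/c\<close> with the orientation reversed.
\<close>
definition vertical :: "real \<Rightarrow> complex"
  where "vertical t = of_real (- real_of_int d / real_of_int c) + \<i> * of_real t"

text \<open>
The value 0 at the cusp \<open>-d/c\<close> is the limit of \<open>g\<close> there, which makes the function continuous on the
closed half-line.
\<close>
definition boundary_value :: "'r \<Rightarrow> real \<Rightarrow> complex"
  where "boundary_value k t = (if t = 0 then 0 else g k (vertical t))"

lemma Im_action: "Im w > 0 \<Longrightarrow> Im (\<gamma> w) > 0"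
proof -
  assume w: "Im w > 0"
  have "of_int c * w + of_int d \<noteq> 0" using csqrt_affine_nonzero[OF c w, of d] by auto
  moreover have "real_of_int a * real_of_int d - real_of_int b * real_of_int c = 1"
    using det by (metis of_int_1 of_int_diff of_int_mult)
  ultimately show ?thesis unfolding \<gamma>_def using w Im_moebius[of a b c d w] by simp
qed

lemma Im_vertical [simp]: "Im (vertical t) = t"
  by (simp add: vertical_def)

lemma Re_vertical: "Re (vertical t) = - real_of_int d / real_of_int c"
  by (simp add: vertical_def)

lemma affine_vertical: "of_int c * vertical t + of_int d = \<i> * of_real (real_of_int c * t)"
  using c by (simp add: vertical_def complex_eq_iff)

lemma action_vertical:
  assumes "t > 0"
  shows "\<gamma> (vertical t) = of_real (real_of_int a / real_of_int c) + \<i> * of_real (1 / ((real_of_int c)\<^sup>2 * t))"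
proof -
  have bc: "of_int b * of_int c = of_int a * of_int d - (1 :: complex)"
    using det by (metis add_diff_cancel_left' diff_add_cancel of_int_1 of_int_diff of_int_mult)
  have c0: "of_int c \<noteq> (0::complex)" and t0: "of_real t \<noteq> (0::complex)" using c assms by auto
  have den: "\<i> * of_real (real_of_int c * t) \<noteq> 0" using c assms by simp
  have "(of_real (real_of_int a / real_of_int c) + \<i> * of_real (1 / ((real_of_int c)\<^sup>2 * t))) * (\<i> * of_real (real_of_int c * t))
     = of_int a * (\<i> * of_real t) - 1 / of_int c"
    using c0 t0 by (simp add: field_simps power2_eq_square)
  also have "\<dots> = of_int a * vertical t + of_int b"
  proof -
    have cv: "of_int c * vertical t = \<i> * of_real (real_of_int c * t) - of_int d"
      using affine_vertical[of t] by (simp add: algebra_simps)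
    have "of_int c * (of_int a * (\<i> * of_real t) - 1 / of_int c) = of_int a * (\<i> * of_real (real_of_int c * t)) - 1"
      using c0 by (simp add: right_diff_distrib)
    also have "\<dots> = of_int a * (of_int c * vertical t) + of_int b * of_int c"
      unfolding cv bc by (simp add: right_diff_distrib)
    also have "\<dots> = of_int c * (of_int a * vertical t + of_int b)" by (simp add: algebra_simps)
    finally have "of_int c * (of_int a * (\<i> * of_real t) - 1 / of_int c) = of_int c * (of_int a * vertical t + of_int b)" .
    then show ?thesis using c0 by simp
  qed
  finally show ?thesis unfolding \<gamma>_def moebius_def affine_vertical
    using den by (simp only: divide_eq_eq not_False_eq_True if_True)
qed

lemma law_inverse:
  assumes "Im w > 0"
  shows "g k w = (\<Sum>j\<in>UNIV. Rinv k j * g j (\<gamma> w)) / s w ^ (4 - N)"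
proof -
  have s0: "s w \<noteq> 0" using csqrt_affine_nonzero[OF c assms, of d] by (auto simp: s_def)
  have "(\<Sum>j\<in>UNIV. Rinv k j * g j (\<gamma> w)) = s w ^ (4 - N) * (\<Sum>j\<in>UNIV. \<Sum>i\<in>UNIV. Rinv k j * R j i * g i w)"
    unfolding law[OF assms] sum_distrib_left by (simp add: mult_ac)
  also have "(\<Sum>j\<in>UNIV. \<Sum>i\<in>UNIV. Rinv k j * R j i * g i w) = (\<Sum>i\<in>UNIV. (\<Sum>j\<in>UNIV. Rinv k j * R j i) * g i w)"
    unfolding sum_distrib_right by (rule sum.swap)
  also have "\<dots> = (\<Sum>i\<in>UNIV. if i = k then g i w else 0)"
    unfolding inverse by (intro sum.cong) auto
  also have "\<dots> = g k w" by simp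
  finally show ?thesis using s0 by simp
qed

lemma isCont_g:
  assumes "Im w > 0"
  shows "isCont (g k) w"
  unfolding g_def by (rule DERIV_isCont[OF q_series_has_field_derivative[OF coeffs assms]])

lemma g_decay: "\<exists>K\<ge>0. \<forall>\<tau>. Im \<tau> \<ge> 1 \<longrightarrow> norm (g k \<tau>) \<le> K / (Im \<tau>)\<^sup>2"
proof -
  have "\<exists>K\<ge>0. \<forall>\<tau>. Im \<tau> \<ge> 1 \<longrightarrow> norm (q_series (\<alpha> k) (A k) \<tau>) \<le> K / (Im \<tau>)\<^sup>2"
    by (rule q_series_decay[OF coeffs[of k]]) blast
  then show ?thesis unfolding g_def .
qed

text \<open>
Near the cusp \<open>-d/c\<close> the transformation law expresses \<open>g\<close> by its values at height \<open>1 / (c^2 t)\<close>.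
With \<open>r = |s|\<close>, so that \<open>r^2 = |c| t\<close>, the decay contributes \<open>r^4\<close> and the weight \<open>r^(N - 4)\<close>.
\<close>
lemma boundary_value_bound:
  obtains B where "\<And>t. t \<ge> 0 \<Longrightarrow> t \<le> 1 / (real_of_int c)\<^sup>2 \<Longrightarrow>
     norm (boundary_value k t) \<le> B * sqrt (\<bar>real_of_int c\<bar> * t) ^ N"
proof -
  have "\<exists>K. \<forall>j. K j \<ge> 0 \<and> (\<forall>\<tau>. Im \<tau> \<ge> 1 \<longrightarrow> norm (g j \<tau>) \<le> K j / (Im \<tau>)\<^sup>2)"
    by (rule choice) (use g_decay in auto)
  then obtain K where K: "\<And>j \<tau>. Im \<tau> \<ge> 1 \<Longrightarrow> norm (g j \<tau>) \<le> K j / (Im \<tau>)\<^sup>2" by blast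
  define C where "C = \<bar>real_of_int c\<bar>"
  have C: "C > 0" using c by (simp add: C_def)
  have C2: "(real_of_int c)\<^sup>2 = C\<^sup>2" by (simp add: C_def)
  define B where "B = (\<Sum>j\<in>UNIV. norm (Rinv k j) * (K j * C\<^sup>2))"
  show thesis
  proof (rule that[of B])
    fix t :: real assume t: "t \<ge> 0" "t \<le> 1 / (real_of_int c)\<^sup>2"
    show "norm (boundary_value k t) \<le> B * sqrt (\<bar>real_of_int c\<bar> * t) ^ N"
    proof (cases "t = 0")
      case True
      then show ?thesis using N by (auto simp: boundary_value_def)
    next
      case False
      then have t0: "t > 0" using t by simp
      define r where "r = sqrt (C * t)"
      have r: "r > 0" "r\<^sup>2 = C * t" using C t0 by (simp_all add: r_def)
      have ns: "norm (s (vertical t)) = r"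
        unfolding s_def affine_vertical norm_csqrt r_def C_def using t0 by (simp add: norm_mult abs_mult)
      have im: "Im (\<gamma> (vertical t)) = 1 / (C\<^sup>2 * t)"
        unfolding action_vertical[OF t0] C2[symmetric] by simp
      have "C\<^sup>2 * t \<le> 1" using t(2) C unfolding C2 by (simp add: field_simps)
      then have im1: "Im (\<gamma> (vertical t)) \<ge> 1" unfolding im using C t0 by simp
      have gj: "norm (g j (\<gamma> (vertical t))) \<le> K j * C\<^sup>2 * r ^ 4" for j
      proof -
        have "r ^ 4 = (C * t)\<^sup>2" unfolding r(2)[symmetric] by simp
        then have "K j / (Im (\<gamma> (vertical t)))\<^sup>2 = K j * C\<^sup>2 * r ^ 4"
          unfolding im using C t0 by (simp add: field_simps power2_eq_square)
        then show ?thesis using K[OF im1, of j] by simp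
      qed
      have "norm (\<Sum>j\<in>UNIV. Rinv k j * g j (\<gamma> (vertical t))) \<le> (\<Sum>j\<in>UNIV. norm (Rinv k j) * (K j * C\<^sup>2 * r ^ 4))"
        by (intro sum_norm_le) (auto simp: norm_mult intro!: mult_left_mono gj)
      also have "\<dots> = B * r ^ 4" unfolding B_def sum_distrib_right by (simp add: mult_ac)
      finally have "norm (g k (vertical t)) \<le> B * r ^ 4 / r ^ (4 - N)"
        using t0 r(1) unfolding law_inverse[of "vertical t" k, simplified, OF t0] norm_divide norm_power ns
        by (intro divide_right_mono) auto
      also have "r ^ 4 = r ^ N * r ^ (4 - N)" using N by (auto simp: power_add[symmetric])
      also have "B * (r ^ N * r ^ (4 - N)) / r ^ (4 - N) = B * r ^ N" using r(1) by simp
      finally show ?thesis using t0 unfolding boundary_value_def r_def C_def by simp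
    qed
  qed
qed

lemma boundary_value_continuous: "continuous_on {0..} (boundary_value k)"
proof -
  define C where "C = \<bar>real_of_int c\<bar>"
  have C: "C > 0" using c by (simp add: C_def)
  obtain B where B: "\<And>t. t \<ge> 0 \<Longrightarrow> t \<le> 1 / (real_of_int c)\<^sup>2 \<Longrightarrow> norm (boundary_value k t) \<le> B * sqrt (C * t) ^ N"
    unfolding C_def by (rule boundary_value_bound[of k]) blast
  have at0: "(boundary_value k \<longlongrightarrow> 0) (at 0 within {0..})"
  proof (rule Lim_null_comparison)
    have "\<forall>\<^sub>F t in at 0 within {0..}. t \<in> {0..} \<and> t < 1 / (real_of_int c)\<^sup>2"
    proof (rule eventually_conj)
      show "\<forall>\<^sub>F t in at 0 within {0..}. t \<in> {0::real..}" by (simp add: eventually_at_filter)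
      show "\<forall>\<^sub>F t in at 0 within {0::real..}. t < 1 / (real_of_int c)\<^sup>2"
        using c by (intro order_tendstoD(2)[OF tendsto_ident_at]) simp
    qed
    then show "\<forall>\<^sub>F t in at 0 within {0..}. norm (boundary_value k t) \<le> B * sqrt (C * t) ^ N"
      by eventually_elim (intro B, auto)
    have "((\<lambda>t. B * sqrt (C * t) ^ N) \<longlongrightarrow> B * sqrt (C * 0) ^ N) (at 0 within {0..})"
      by (intro tendsto_intros)
    then show "((\<lambda>t. B * sqrt (C * t) ^ N) \<longlongrightarrow> 0) (at 0 within {0..})" using N by auto
  qed
  show ?thesis
  proof (rule continuous_on_eq_continuous_within[THEN iffD2], rule ballI)
    fix t :: real assume "t \<in> {0..}"
    then consider "t = 0" | "t > 0" by fastforce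
    then show "continuous (at t within {0..}) (boundary_value k)"
    proof cases
      case 1
      then show ?thesis using at0 by (simp add: continuous_within boundary_value_def)
    next
      case 2
      have "isCont (\<lambda>t. g k (vertical t)) t"
        by (rule isCont_o2[OF _ isCont_g]) (use 2 in \<open>auto simp: vertical_def intro!: continuous_intros\<close>)
      moreover have "\<forall>\<^sub>F x in nhds t. boundary_value k x = g k (vertical x)"
      proof -
        have "\<forall>\<^sub>F x in nhds t. x > 0" using 2 by (intro order_tendstoD(1)[OF filterlim_ident])
        then show ?thesis by eventually_elim (simp add: boundary_value_def)
      qed
      ultimately have "isCont (boundary_value k) t" by (simp add: isCont_cong)
      then show ?thesis by (rule continuous_at_imp_continuous_at_within)
    qed
  qed
qed

lemma boundary_value_decay:
  obtains K where "\<And>t. t \<ge> 0 \<Longrightarrow> norm (boundary_value k t) \<le> K / (1 + t)\<^sup>2"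
proof -
  obtain K where K: "K \<ge> 0" "\<And>\<tau>. Im \<tau> \<ge> 1 \<Longrightarrow> norm (g k \<tau>) \<le> K / (Im \<tau>)\<^sup>2"
    using g_decay[of k] by auto
  have "compact (boundary_value k ` {0..1})"
    by (intro compact_continuous_image continuous_on_subset[OF boundary_value_continuous]) auto
  then obtain B where "\<forall>x\<in>boundary_value k ` {0..1}. norm x \<le> B"
    using compact_imp_bounded bounded_iff by blast
  then have B: "\<And>t. 0 \<le> t \<Longrightarrow> t \<le> 1 \<Longrightarrow> norm (boundary_value k t) \<le> B" by auto
  have B0: "B \<ge> 0" using order.trans[OF norm_ge_zero B[of 0]] by simp
  show thesis
  proof (rule that[of "4 * B + 4 * K"])
    fix t :: real assume t: "t \<ge> 0"
    have pos: "(1 + t)\<^sup>2 > 0" using t by simp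
    show "norm (boundary_value k t) \<le> (4 * B + 4 * K) / (1 + t)\<^sup>2"
    proof (cases "t \<le> 1")
      case True
      have "(1 + t)\<^sup>2 \<le> 2\<^sup>2" using t True by (intro power_mono) auto
      then have "B * (1 + t)\<^sup>2 \<le> B * 4" using B0 by (intro mult_left_mono) auto
      moreover have "norm (boundary_value k t) * (1 + t)\<^sup>2 \<le> B * (1 + t)\<^sup>2"
        using B[OF t True] by (rule mult_right_mono) simp
      ultimately have "norm (boundary_value k t) * (1 + t)\<^sup>2 \<le> 4 * B + 4 * K" using K(1) by linarith
      then show ?thesis using pos by (simp only: pos_le_divide_eq)
    next
      case False
      have "norm (boundary_value k t) \<le> K / t\<^sup>2" using K(2)[of "vertical t"] False by (simp add: boundary_value_def)
      then have "norm (boundary_value k t) * t\<^sup>2 \<le> K" using False by (simp add: pos_le_divide_eq)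
      moreover have "norm (boundary_value k t) * (1 + t)\<^sup>2 \<le> norm (boundary_value k t) * (2 * t)\<^sup>2"
        using False by (intro mult_left_mono power_mono) auto
      ultimately have "norm (boundary_value k t) * (1 + t)\<^sup>2 \<le> 4 * B + 4 * K"
        using B0 by (simp add: power_mult_distrib)
      then show ?thesis using pos by (simp only: pos_le_divide_eq)
    qed
  qed
qed

lemma Re_action_vertical: "t > 0 \<Longrightarrow> Re (\<gamma> (vertical t)) = real_of_int a / real_of_int c"
  and Im_action_vertical: "t > 0 \<Longrightarrow> Im (\<gamma> (vertical t)) = 1 / ((real_of_int c)\<^sup>2 * t)"
proof -
  have "Re (of_real x + \<i> * of_real y) = x" "Im (of_real x + \<i> * of_real y) = y" for x y by simp_all
  then show "t > 0 \<Longrightarrow> Re (\<gamma> (vertical t)) = real_of_int a / real_of_int c"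
    "t > 0 \<Longrightarrow> Im (\<gamma> (vertical t)) = 1 / ((real_of_int c)\<^sup>2 * t)"
    by (simp_all only: action_vertical)
qed

text \<open>
A square root of \<open>-1/c\<close>. This one is chosen so that \<open>ray_const * csqrt (c (\<tau> - w))\<close>, as \<open>w\<close> runs through
the vertical line, stays in the half-plane around the direction \<open>cis (pi/4)\<close>, for either sign
of \<open>c\<close>.
\<close>
definition ray_const :: complex
  where "ray_const = csqrt (\<i> * of_int c) * cis (pi/4) / of_real \<bar>real_of_int c\<bar>"

lemma ray_const_square: "ray_const\<^sup>2 * of_int c = -1"
proof -
  have e: "(of_real \<bar>real_of_int c\<bar>)\<^sup>2 = (of_int c)\<^sup>2 * (1::complex)"
    by (metis of_real_of_int_eq of_real_power power2_abs mult_1_right)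
  have c0: "of_int c \<noteq> (0::complex)" using c by simp
  have "ray_const\<^sup>2 = \<i> * of_int c * \<i> / ((of_int c)\<^sup>2 * 1)"
    unfolding ray_const_def power_divide power_mult_distrib e power2_csqrt cis_pi4_square ..
  then show ?thesis using c0 by (simp add: power2_eq_square)
qed

lemma ray_const_nonzero: "ray_const \<noteq> 0"
  using ray_const_square by force

lemma g_primitive:
  assumes "Im \<tau> > 0"
  shows "\<exists>P. odd_primitive N (g k) \<tau> P \<and>
    ((\<lambda>r. P (cis (pi/4) * of_real r)) \<longlongrightarrow> eichler_const N * EI k \<tau>) at_top"
proof -
  have "\<exists>P. odd_primitive N (q_series (\<alpha> k) (A k)) \<tau> P \<and>
    ((\<lambda>r. P (cis (pi/4) * of_real r)) \<longlongrightarrow> eichler_const N *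
       q_series (\<alpha> k) (\<lambda>n. of_real ((\<alpha> k + real n) powr (real N / 2 - 1)) * A k n) \<tau>) at_top"
    by (rule ex_odd_primitive[OF coeffs[of k] assms N]) blast
  then show ?thesis unfolding g_def EI_def .
qed

text \<open>
To the right of the vertical line (in terms of \<open>c \<tau> + d\<close>) the integral along that line is an
increment of the odd primitive at \<open>\<tau>\<close>. Its limit at the upper end is the Eichler integral at
\<open>\<tau>\<close>. At the lower end the transformation law carries the primitive to the one at
\<open>\<gamma> \<tau>\<close>, along a path that again ends in the cusp at infinity, and the limit is the Eichler
integral at \<open>\<gamma> \<tau>\<close>.
\<close>
lemma period_integral:
  assumes \<tau>: "Im \<tau> > 0" and right: "Re (of_int c * \<tau> + of_int d) > 0"
  shows "(\<lambda>n. integral {0..real n} (\<lambda>t. boundary_value k t /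
            csqrt (of_int c * \<tau> + of_int d - \<i> * of_real (real_of_int c * t)) ^ N)) \<longlonglongrightarrow>
     ray_const ^ N / \<i> * eichler_const N * (EI k \<tau> - (\<Sum>j\<in>UNIV. Rinv k j * EI j (\<gamma> \<tau>)) / s \<tau> ^ N)"
proof -
  define u where "u = of_int c * \<tau> + of_int d"
  define q where "q = (\<lambda>t. csqrt (u - \<i> * of_real (real_of_int c * t)))"
  define z where "z = (\<lambda>t. ray_const * q t)"
  define z' where "z' = (\<lambda>t. z t / (s (vertical t) * s \<tau>))"
  have c0: "of_int c \<noteq> (0::complex)" and rc: "real_of_int c \<noteq> 0" using c by auto
  have slit: "u - \<i> * of_real (real_of_int c * t) \<notin> \<real>\<^sub>\<le>\<^sub>0" if "t \<ge> 0" for t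
    using right that rc by (intro slit_shift) (auto simp: u_def)
  have q0: "q t \<noteq> 0" if "t \<ge> 0" for t using slit[OF that] by (auto simp: q_def)
  have z0: "z t \<noteq> 0" if "t \<ge> 0" for t using q0[OF that] ray_const_nonzero by (simp add: z_def)
  have z_sq: "(z t)\<^sup>2 = vertical t - \<tau>" for t
  proof -
    have "of_int c * (z t)\<^sup>2 = (ray_const\<^sup>2 * of_int c) * (u - \<i> * of_real (real_of_int c * t))"
      by (simp add: z_def q_def power_mult_distrib)
    also have "\<dots> = of_int c * (vertical t - \<tau>)"
      unfolding ray_const_square using affine_vertical[of t] by (simp add: u_def algebra_simps)
    finally show ?thesis using c0 by simp
  qed
  have q_right: "\<bar>Im (q t)\<bar> < Re (q t)" for t
    unfolding q_def using right by (intro csqrt_quadrant_less) (simp add: u_def)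
  have cis_inv: "cis (pi/4) * cis (-(pi/4)) = 1" unfolding cis_mult right_minus by (rule cis_zero)
  have z_rot: "z t * cis (-(pi/4)) = csqrt (\<i> * of_int c) * q t / of_real \<bar>real_of_int c\<bar>" for t
  proof -
    have "z t * cis (-(pi/4)) = csqrt (\<i> * of_int c) * q t / of_real \<bar>real_of_int c\<bar> * (cis (pi/4) * cis (-(pi/4)))"
      unfolding z_def ray_const_def by (simp only: times_divide_eq_left times_divide_eq_right mult_ac)
    then show ?thesis unfolding cis_inv by simp
  qed
  have ic0: "csqrt (\<i> * of_int c) \<noteq> 0" using c0 by simp
  have side: "Re (z t * cis (-(pi/4))) > 0" for t
  proof -
    have "Re (csqrt (\<i> * of_int c) * q t) > 0"
      by (intro Re_mult_pos csqrt_quadrant_le ic0 q_right) simp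
    then show ?thesis unfolding z_rot Re_divide_of_real using rc by simp
  qed
  have s\<tau>: "s \<tau> = csqrt u" by (simp add: s_def u_def)
  have s0: "s w \<noteq> 0" if "Im w > 0" for w using csqrt_affine_nonzero[OF c that, of d] by (auto simp: s_def)
  \<comment> \<open>On the line, c w + d = i c t, whose square root separates into modulus and direction.\<close>
  have s_vert: "s (vertical t) = of_real (sqrt t) * csqrt (\<i> * of_int c)" if "t > 0" for t
  proof -
    have "csqrt (\<i> * of_real (real_of_int c * t)) = of_real (sqrt t) * csqrt (\<i> * of_int c)"
    proof (rule csqrt_unique)
      have "(of_real (sqrt t))\<^sup>2 = (of_real t :: complex)" using that by (metis less_imp_le of_real_power real_sqrt_pow2)
      then show "(of_real (sqrt t) * csqrt (\<i> * of_int c))\<^sup>2 = \<i> * of_real (real_of_int c * t)"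
        by (simp add: power_mult_distrib)
      define p where "p = csqrt (\<i> * of_int c)"
      have "\<bar>Im p\<bar> \<le> Re p" unfolding p_def by (rule csqrt_quadrant_le) simp
      moreover have "p \<noteq> 0" using ic0 by (simp add: p_def)
      ultimately have "Re p > 0" by (auto simp: complex_eq_iff)
      then have "0 < Re (of_real (sqrt t) * p)" using that by simp
      then show "0 < Re (of_real (sqrt t) * csqrt (\<i> * of_int c)) \<or>
         Re (of_real (sqrt t) * csqrt (\<i> * of_int c)) = 0 \<and> 0 \<le> Im (of_real (sqrt t) * csqrt (\<i> * of_int c))"
        unfolding p_def by (rule disjI1)
    qed
    then show ?thesis by (simp only: s_def affine_vertical)
  qed
  \<comment> \<open>The lifted path also stays near the direction of the ray: its direction is that of q t / csqrt u, a quotient of two square roots of numbers with positive real part.\<close>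
  have side': "Re (z' t * cis (-(pi/4))) > 0" if "t > 0" for t
  proof -
    have "z' t * cis (-(pi/4)) = (z t * cis (-(pi/4))) / (s (vertical t) * s \<tau>)" by (simp add: z'_def)
    also have "\<dots> = q t / csqrt u / of_real (\<bar>real_of_int c\<bar> * sqrt t)"
    proof -
      have "(x * y / C) / (r * x * v) = y / v / (C * r)" if "x \<noteq> 0" for x y C r v :: complex
        using that by (simp add: field_simps)
      from this[OF ic0] show ?thesis unfolding z_rot s_vert[OF that] s\<tau> of_real_mult .
    qed
    finally have e: "z' t * cis (-(pi/4)) = q t / csqrt u / of_real (\<bar>real_of_int c\<bar> * sqrt t)" .
    have "Re (q t / csqrt u) > 0"
    proof (rule Re_divide_pos)
      show "\<bar>Im (q t)\<bar> \<le> Re (q t)" using q_right[of t] by simp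
      show "q t \<noteq> 0" using q0 that by simp
      show "\<bar>Im (csqrt u)\<bar> < Re (csqrt u)" using right by (intro csqrt_quadrant_less) (simp add: u_def)
    qed
    moreover have "\<bar>real_of_int c\<bar> * sqrt t > 0" using rc that by simp
    ultimately show ?thesis unfolding e Re_divide_of_real by (rule divide_pos_pos)
  qed
  have z'_sq: "(z' t)\<^sup>2 = \<gamma> (vertical t) - \<gamma> \<tau>" if "t > 0" for t
  proof -
    have "of_int a * of_int d - of_int b * of_int c = (1 :: complex)"
      using det by (metis of_int_1 of_int_diff of_int_mult)
    moreover have "of_int c * vertical t + of_int d \<noteq> (0::complex)" "of_int c * \<tau> + of_int d \<noteq> (0::complex)"
      using csqrt_affine_nonzero[OF c, of "vertical t" d] csqrt_affine_nonzero[OF c \<tau>, of d] that by auto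
    ultimately have "\<gamma> (vertical t) - \<gamma> \<tau> = (vertical t - \<tau>) / ((of_int c * vertical t + of_int d) * (of_int c * \<tau> + of_int d))"
      unfolding \<gamma>_def by (rule moebius_diff)
    then show ?thesis by (simp add: z'_def z_sq power_divide power_mult_distrib s_def)
  qed
  have "\<forall>j. \<exists>P. odd_primitive N (g j) \<tau> P \<and> ((\<lambda>r. P (cis (pi/4) * of_real r)) \<longlongrightarrow> eichler_const N * EI j \<tau>) at_top"
    using g_primitive[OF \<tau>] by blast
  from choice[OF this] obtain P where P: "\<And>j. odd_primitive N (g j) \<tau> (P j)"
    "\<And>j. ((\<lambda>r. P j (cis (pi/4) * of_real r)) \<longlongrightarrow> eichler_const N * EI j \<tau>) at_top" by blast
  have "\<forall>j. \<exists>P. odd_primitive N (g j) (\<gamma> \<tau>) P \<and> ((\<lambda>r. P (cis (pi/4) * of_real r)) \<longlongrightarrow> eichler_const N * EI j (\<gamma> \<tau>)) at_top"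
    using g_primitive[OF Im_action[OF \<tau>]] by blast
  from choice[OF this] obtain P' where P': "\<And>j. odd_primitive N (g j) (\<gamma> \<tau>) (P' j)"
    "\<And>j. ((\<lambda>r. P' j (cis (pi/4) * of_real r)) \<longlongrightarrow> eichler_const N * EI j (\<gamma> \<tau>)) at_top" by blast
  have Npos: "N > 0" using N by auto
  obtain K where K: "\<And>w. Im w \<ge> 1 \<Longrightarrow> norm (g k w) \<le> K / (Im w)\<^sup>2" using g_decay[of k] by blast
  have top: "((\<lambda>t. P k (z t)) \<longlongrightarrow> eichler_const N * EI k \<tau>) at_top"
    by (rule odd_primitive_tendsto[OF P(1)[of k] Npos K P(2)[of k], where w = vertical and x = "- real_of_int d / real_of_int c"])
       (simp_all only: z_sq side Re_vertical Im_vertical filterlim_ident always_eventually simp_thms)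
  have bot': "((\<lambda>t. P' j (z' t)) \<longlongrightarrow> eichler_const N * EI j (\<gamma> \<tau>)) (at_right 0)" for j
  proof -
    obtain K where K: "\<And>w. Im w \<ge> 1 \<Longrightarrow> norm (g j w) \<le> K / (Im w)\<^sup>2" using g_decay[of j] by blast
    have pos: "\<forall>\<^sub>F t::real in at_right 0. t > 0" by (simp add: eventually_at_right_less)
    show ?thesis
    proof (rule odd_primitive_tendsto[OF P'(1)[of j] Npos K P'(2)[of j], where w = "\<lambda>t. \<gamma> (vertical t)" and x = "real_of_int a / real_of_int c"])
      show "\<forall>\<^sub>F t in at_right 0. (z' t)\<^sup>2 = \<gamma> (vertical t) - \<gamma> \<tau>"
        using pos by eventually_elim (rule z'_sq)
      show "\<forall>\<^sub>F t in at_right 0. Re (z' t * cis (-(pi/4))) > 0"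
        using pos by eventually_elim (rule side')
      show "\<forall>\<^sub>F t in at_right 0. Re (\<gamma> (vertical t)) = real_of_int a / real_of_int c"
        using pos by eventually_elim (rule Re_action_vertical)
      have "filterlim (\<lambda>t::real. 1 / (real_of_int c)\<^sup>2 * inverse t) at_top (at_right 0)"
        by (rule filterlim_tendsto_pos_mult_at_top[OF tendsto_const _ filterlim_inverse_at_top_right]) (use rc in simp)
      moreover have "\<forall>\<^sub>F t in at_right 0. 1 / (real_of_int c)\<^sup>2 * inverse t = Im (\<gamma> (vertical t))"
        using pos by eventually_elim (simp add: Im_action_vertical divide_inverse)
      ultimately show "filterlim (\<lambda>t. Im (\<gamma> (vertical t))) at_top (at_right 0)"
        by (rule filterlim_mono_eventually[OF _ order_refl order_refl])
    qed
  qed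
  have trans: "P k (z t) = (\<Sum>j\<in>UNIV. Rinv k j * P' j (z' t)) / s \<tau> ^ N" if t: "t > 0" for t
  proof -
    have vt: "\<tau> + (z t)\<^sup>2 = vertical t" by (simp add: z_sq)
    have imv: "Im (\<tau> + (z t)\<^sup>2) > 0" unfolding vt using t by simp
    have zt: "z t \<noteq> 0" using z0 t by simp
    have pj: "P' j (z' t) = s \<tau> ^ N * (\<Sum>i\<in>UNIV. R j i * P i (z t))" for j
      using odd_primitive_transform[where g = g and g' = "g j" and R = "R j" and a = a and b = b and c = c and d = d
          and N = N and P = P and P' = "P' j" and \<tau> = \<tau> and z = "z t", folded \<gamma>_def,
          OF det c N \<tau> Im_action law[unfolded s_def] P(1) P'(1) zt imv]
      unfolding vt z'_def s_def .
    have "(\<Sum>j\<in>UNIV. Rinv k j * P' j (z' t)) = (\<Sum>j\<in>UNIV. s \<tau> ^ N * (\<Sum>i\<in>UNIV. Rinv k j * R j i * P i (z t)))"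
      unfolding pj by (intro sum.cong refl) (simp only: sum_distrib_left mult_ac)
    also have "\<dots> = s \<tau> ^ N * (\<Sum>j\<in>UNIV. \<Sum>i\<in>UNIV. Rinv k j * R j i * P i (z t))"
      by (simp only: sum_distrib_left)
    also have "(\<Sum>j\<in>UNIV. \<Sum>i\<in>UNIV. Rinv k j * R j i * P i (z t)) = (\<Sum>i\<in>UNIV. (\<Sum>j\<in>UNIV. Rinv k j * R j i) * P i (z t))"
      unfolding sum_distrib_right by (rule sum.swap)
    also have "\<dots> = (\<Sum>i\<in>UNIV. if i = k then P i (z t) else 0)"
      unfolding inverse by (intro sum.cong) auto
    also have "\<dots> = P k (z t)" by simp
    finally show ?thesis using s0[OF \<tau>] by simp
  qed
  define l0 where "l0 = (\<Sum>j\<in>UNIV. Rinv k j * (eichler_const N * EI j (\<gamma> \<tau>))) / s \<tau> ^ N"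
  have bot: "((\<lambda>t. P k (z t)) \<longlongrightarrow> l0) (at_right 0)"
  proof (rule Lim_transform_eventually)
    show "((\<lambda>t. (\<Sum>j\<in>UNIV. Rinv k j * P' j (z' t)) / s \<tau> ^ N) \<longlongrightarrow> l0) (at_right 0)"
      unfolding l0_def using s0[OF \<tau>] by (intro tendsto_intros bot') simp
    have "\<forall>\<^sub>F t::real in at_right 0. t > 0" by (simp add: eventually_at_right_less)
    then show "\<forall>\<^sub>F t in at_right 0. (\<Sum>j\<in>UNIV. Rinv k j * P' j (z' t)) / s \<tau> ^ N = P k (z t)"
      by eventually_elim (simp only: trans)
  qed
  define Q where "Q = (\<lambda>t. if t = 0 then l0 else P k (z t))"
  define f where "f = (\<lambda>t. boundary_value k t / q t ^ N)"
  have Q_der: "(Q has_vector_derivative \<i> / ray_const ^ N * f t) (at t)" if t: "t > 0" for t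
  proof -
    have vt: "\<tau> + (z t)\<^sup>2 = vertical t" by (simp add: z_sq)
    have imv: "Im (\<tau> + (z t)\<^sup>2) > 0" unfolding vt using t by simp
    have zt: "z t \<noteq> 0" and qt: "q t \<noteq> 0" using z0 q0 t by simp_all
    have lin: "((\<lambda>t. u - \<i> * of_real (real_of_int c * t)) has_vector_derivative - \<i> * of_real (real_of_int c)) (at t)"
      by (auto intro!: derivative_eq_intros)
    have "((\<lambda>t. ray_const * q t) has_vector_derivative ray_const * (- \<i> * of_real (real_of_int c) * inverse (2 * q t))) (at t)"
      unfolding q_def
      by (rule has_vector_derivative_mult_right,
          rule field_vector_diff_chain_at[where g = csqrt, unfolded o_def, OF lin has_field_derivative_csqrt])
         (use slit t in simp)
    also have "ray_const * (- \<i> * of_real (real_of_int c) * inverse (2 * q t)) = \<i> / (2 * z t)"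
    proof -
      have "ray_const * (- \<i> * of_int c * inverse (2 * q t)) * (2 * (ray_const * q t))
         = - \<i> * (ray_const\<^sup>2 * of_int c) * (inverse (2 * q t) * (2 * q t))"
        by (simp only: power2_eq_square mult_ac)
      also have "inverse (2 * q t) * (2 * q t) = 1" using qt by (intro left_inverse) simp
      finally have "ray_const * (- \<i> * of_int c * inverse (2 * q t)) * (2 * (ray_const * q t)) = \<i>"
        unfolding ray_const_square by simp
      then show ?thesis using zt unfolding z_def by (intro eq_divide_imp) auto
    qed
    finally have dz: "(z has_vector_derivative \<i> / (2 * z t)) (at t)" unfolding z_def .
    from field_vector_diff_chain_at[where g = "P k", OF dz odd_primitiveD(1)[OF P(1) zt imv]]
    have "((\<lambda>t. P k (z t)) has_vector_derivative (\<i> / (2 * z t)) * (2 * g k (vertical t) / z t ^ (N - 1))) (at t)"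
      unfolding vt o_def .
    also have "(\<i> / (2 * z t)) * (2 * g k (vertical t) / z t ^ (N - 1)) = \<i> * g k (vertical t) / z t ^ N"
      using N by (auto simp: power2_eq_square power3_eq_cube)
    also have "\<dots> = \<i> / ray_const ^ N * f t"
      using t by (simp add: f_def boundary_value_def z_def power_mult_distrib)
    finally have 1: "((\<lambda>t. P k (z t)) has_vector_derivative \<i> / ray_const ^ N * f t) (at t)" .
    show ?thesis
    proof (rule has_vector_derivative_transform_within_open[OF 1])
      show "open {0::real<..}" "t \<in> {0<..}" using t by auto
      show "P k (z x) = Q x" if "x \<in> {0<..}" for x using that by (simp add: Q_def)
    qed
  qed
  have Q_cont: "continuous_on {0..b} Q" for b
  proof (rule continuous_on_eq_continuous_within[THEN iffD2], rule ballI)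
    fix t assume t: "t \<in> {0..b}"
    show "continuous (at t within {0..b}) Q"
    proof (cases "t = 0")
      case True
      have "(Q \<longlongrightarrow> l0) (at_right 0)"
        by (rule Lim_transform_eventually[OF bot])
           (auto simp: Q_def eventually_at_filter)
      then have "(Q \<longlongrightarrow> l0) (at 0 within {0<..b})" by (rule tendsto_within_subset) auto
      moreover have "at 0 within {0..b} = at 0 within {0<..b}"
      proof -
        have "{0..b} - {0} = {0<..b} - {0}" by auto
        then show ?thesis by (simp only: at_within_def)
      qed
      ultimately show ?thesis unfolding True continuous_within by (simp add: Q_def)
    next
      case False
      then have "t > 0" using t by simp
      from has_vector_derivative_continuous[OF Q_der[OF this]] show ?thesis
        by (rule continuous_at_imp_continuous_at_within)
    qed
  qed
  have int: "integral {0..b} f = ray_const ^ N / \<i> * (Q b - Q 0)" if b: "b \<ge> 0" for b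
  proof -
    have "((\<lambda>t. \<i> / ray_const ^ N * f t) has_integral Q b - Q 0) {0..b}"
      by (rule fundamental_theorem_of_calculus_interior[OF b Q_cont Q_der]) auto
    then have "((\<lambda>t. ray_const ^ N / \<i> * (\<i> / ray_const ^ N * f t)) has_integral ray_const ^ N / \<i> * (Q b - Q 0)) {0..b}"
      by (rule has_integral_mult_right)
    moreover have "ray_const ^ N / \<i> * (\<i> / ray_const ^ N * x) = x" for x
      using ray_const_nonzero by simp
    ultimately show ?thesis by (simp only: integral_unique)
  qed
  have "(\<lambda>n. P k (z (real n))) \<longlonglongrightarrow> eichler_const N * EI k \<tau>"
    by (rule filterlim_compose[OF top filterlim_real_sequentially])
  then have "(\<lambda>n. ray_const ^ N / \<i> * (P k (z (real n)) - l0)) \<longlonglongrightarrow> ray_const ^ N / \<i> * (eichler_const N * EI k \<tau> - l0)"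
    by (intro tendsto_intros)
  moreover have "\<forall>\<^sub>F n in sequentially. ray_const ^ N / \<i> * (P k (z (real n)) - l0) = integral {0..real n} f"
    using eventually_gt_at_top[of 0] by eventually_elim (simp add: int Q_def)
  ultimately have "(\<lambda>n. integral {0..real n} f) \<longlonglongrightarrow> ray_const ^ N / \<i> * (eichler_const N * EI k \<tau> - l0)"
    by (rule Lim_transform_eventually)
  also have "l0 = eichler_const N * ((\<Sum>j\<in>UNIV. Rinv k j * EI j (\<gamma> \<tau>)) / s \<tau> ^ N)"
    by (simp add: l0_def sum_distrib_left mult.left_commute)
  also have "ray_const ^ N / \<i> * (eichler_const N * EI k \<tau> - eichler_const N * ((\<Sum>j\<in>UNIV. Rinv k j * EI j (\<gamma> \<tau>)) / s \<tau> ^ N))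
     = ray_const ^ N / \<i> * eichler_const N * (EI k \<tau> - (\<Sum>j\<in>UNIV. Rinv k j * EI j (\<gamma> \<tau>)) / s \<tau> ^ N)"
    by (simp only: right_diff_distrib mult.assoc)
  finally show ?thesis unfolding f_def q_def u_def .
qed

lemma EI_holomorphic: "EI k holomorphic_on {\<tau>. Im \<tau> > 0}"
  unfolding EI_def by (rule q_series_holomorphic[OF cuspidal_coeffs_eichler[OF coeffs N]])

lemma defect_holomorphic:
  "(\<lambda>\<tau>. (\<Sum>j\<in>UNIV. Rinv k j * EI j (\<gamma> \<tau>)) / s \<tau> ^ N - EI k \<tau>) holomorphic_on {\<tau>. Im \<tau> > 0}"
proof -
  let ?H = "{\<tau>::complex. Im \<tau> > 0}"
  have nn: "of_int c * \<tau> + of_int d \<notin> \<real>\<^sub>\<le>\<^sub>0" if "\<tau> \<in> ?H" for \<tau>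
    using csqrt_affine_nonzero[OF c, of \<tau> d] that by simp
  have nz: "of_int c * \<tau> + of_int d \<noteq> 0" if "\<tau> \<in> ?H" for \<tau>
    using nn[OF that] by auto
  have \<gamma>: "\<gamma> holomorphic_on ?H"
    unfolding \<gamma>_def moebius_def using nz by (intro holomorphic_intros) auto
  have "\<gamma> ` ?H \<subseteq> ?H" using Im_action by auto
  from holomorphic_on_compose_gen[OF \<gamma> EI_holomorphic this]
  have EI\<gamma>: "(\<lambda>\<tau>. EI j (\<gamma> \<tau>)) holomorphic_on ?H" for j by (simp add: o_def)
  have s: "s holomorphic_on ?H"
    unfolding s_def using nn by (intro holomorphic_intros) auto
  have s0: "s \<tau> ^ N \<noteq> 0" if "\<tau> \<in> ?H" for \<tau> using nz[OF that] by (simp add: s_def)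
  show ?thesis using s0 by (intro holomorphic_intros EI\<gamma> s EI_holomorphic) auto
qed

text \<open>
The extension is glued from two pieces: on the upper half-plane the defect itself, and on the
region where \<open>Re (c \<tau> + d) > 0\<close> or \<open>Im \<tau> < 0\<close> the integral along the vertical line. They agree on
the overlap by \<open>period_integral\<close>, and together the two open sets cover the cut plane.
\<close>
lemma defect_extends:
  "\<exists>F. F holomorphic_on {\<tau>. of_int c * \<tau> + of_int d \<notin> \<real>\<^sub>\<le>\<^sub>0} \<and>
     (\<forall>\<tau>. Im \<tau> > 0 \<longrightarrow> F \<tau> = (\<Sum>j\<in>UNIV. Rinv k j * EI j (\<gamma> \<tau>)) / s \<tau> ^ N - EI k \<tau>)"
proof -
  define h where "h = (\<lambda>\<tau>. (\<Sum>j\<in>UNIV. Rinv k j * EI j (\<gamma> \<tau>)) / s \<tau> ^ N - EI k \<tau>)"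
  define H where "H = {\<tau>. Im \<tau> > 0}"
  define W where "W = {u. Re u > 0 \<or> real_of_int c * Im u < 0}"
  define V where "V = {\<tau>. of_int c * \<tau> + of_int d \<in> W}"
  have rc: "real_of_int c \<noteq> 0" using c by simp
  obtain K where K: "\<And>t. t \<ge> 0 \<Longrightarrow> norm (boundary_value k t) \<le> K / (1 + t)\<^sup>2"
    by (rule boundary_value_decay[of k]) blast
  have "\<exists>G. G holomorphic_on W \<and> (\<forall>u. u \<in> W \<longrightarrow>
       (\<lambda>n. integral {0..real n} (\<lambda>t. boundary_value k t / csqrt (u - \<i> * of_real (real_of_int c * t)) ^ N)) \<longlonglongrightarrow> G u)"
    unfolding W_def mem_Collect_eq
    by (rule kernel_integral_holomorphic[OF rc boundary_value_continuous K]) blast+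
  then obtain G where G: "G holomorphic_on W" "\<And>u. u \<in> W \<Longrightarrow>
       (\<lambda>n. integral {0..real n} (\<lambda>t. boundary_value k t / csqrt (u - \<i> * of_real (real_of_int c * t)) ^ N)) \<longlonglongrightarrow> G u"
    by blast
  define C where "C = ray_const ^ N / \<i> * eichler_const N"
  have C: "C \<noteq> 0" using ray_const_nonzero eichler_const_nonzero by (simp add: C_def)
  define f where "f = (\<lambda>\<tau>. - G (of_int c * \<tau> + of_int d) / C)"
  have f_hol: "f holomorphic_on V"
  proof -
    have lin: "(\<lambda>\<tau>. of_int c * \<tau> + of_int d) holomorphic_on V" by (intro holomorphic_intros)
    have "(\<lambda>\<tau>. of_int c * \<tau> + of_int d) ` V \<subseteq> W" by (auto simp: V_def)
    from holomorphic_on_compose_gen[OF lin G(1) this]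
    have "(\<lambda>\<tau>. G (of_int c * \<tau> + of_int d)) holomorphic_on V" by (simp add: o_def)
    then show ?thesis unfolding f_def using C by (intro holomorphic_intros) auto
  qed
  have im: "real_of_int c * Im (of_int c * \<tau> + of_int d) < 0 \<longleftrightarrow> Im \<tau> < 0" for \<tau> :: complex
  proof -
    have e: "real_of_int c * Im (of_int c * \<tau> + of_int d) = (real_of_int c)\<^sup>2 * Im \<tau>"
      by (simp add: power2_eq_square)
    have "(real_of_int c)\<^sup>2 > 0" using rc by simp
    then show ?thesis unfolding e mult_less_0_iff by auto
  qed
  have V_eq: "V = {\<tau>. Re (of_int c * \<tau> + of_int d) > 0 \<or> Im \<tau> < 0}"
    unfolding V_def W_def mem_Collect_eq im ..
  have agree: "h \<tau> = f \<tau>" if "\<tau> \<in> H" "\<tau> \<in> V" for \<tau>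
  proof -
    have "Im \<tau> > 0" "Re (of_int c * \<tau> + of_int d) > 0" using that unfolding V_eq H_def by auto
    note period_integral[OF this, of k]
    moreover have "of_int c * \<tau> + of_int d \<in> W" using that(2) by (simp add: V_def)
    ultimately have "G (of_int c * \<tau> + of_int d) = C * (EI k \<tau> - (\<Sum>j\<in>UNIV. Rinv k j * EI j (\<gamma> \<tau>)) / s \<tau> ^ N)"
      unfolding C_def by (intro LIMSEQ_unique[OF G(2)])
    also have "\<dots> = - (C * h \<tau>)" by (simp add: h_def algebra_simps)
    finally show ?thesis using C by (simp add: f_def)
  qed
  have "open H" unfolding H_def by (rule open_halfspace_Im_gt)
  moreover have "open V" unfolding V_eq by (intro open_Collect_disj open_Collect_less continuous_intros)
  moreover have "h holomorphic_on H" unfolding h_def H_def by (rule defect_holomorphic)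
  ultimately have "(\<lambda>\<tau>. if \<tau> \<in> H then h \<tau> else f \<tau>) holomorphic_on (H \<union> V)"
    using f_hol agree by (intro holomorphic_on_If_Un) auto
  moreover have "{\<tau>. of_int c * \<tau> + of_int d \<notin> \<real>\<^sub>\<le>\<^sub>0} \<subseteq> H \<union> V"
  proof
    fix \<tau> :: complex assume "\<tau> \<in> {\<tau>. of_int c * \<tau> + of_int d \<notin> \<real>\<^sub>\<le>\<^sub>0}"
    then have "Re (of_int c * \<tau> + of_int d) > 0 \<or> Im \<tau> \<noteq> 0"
      using c by (auto simp: complex_nonpos_Reals_iff)
    then show "\<tau> \<in> H \<union> V" unfolding V_eq H_def by auto
  qed
  ultimately have "(\<lambda>\<tau>. if \<tau> \<in> H then h \<tau> else f \<tau>) holomorphic_on {\<tau>. of_int c * \<tau> + of_int d \<notin> \<real>\<^sub>\<le>\<^sub>0}"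
    by (rule holomorphic_on_subset)
  moreover have "(if \<tau> \<in> H then h \<tau> else f \<tau>) = h \<tau>" if "Im \<tau> > 0" for \<tau>
    using that by (simp add: H_def)
  ultimately show ?thesis unfolding h_def by blast
qed

end

section \<open>The multiplier system\<close>

lemma powr_half_csqrt:
  assumes "z \<noteq> 0"
  shows "z powr of_real (real n / 2) = csqrt z ^ n"
    and "z powr (- of_real (real n / 2)) = 1 / csqrt z ^ n"
proof -
  have "csqrt z ^ n = exp (of_nat n * (Ln z / 2))"
    unfolding csqrt_exp_Ln[OF assms] exp_of_nat_mult ..
  also have "of_nat n * (Ln z / 2) = of_real (real n / 2) * Ln z" by simp
  finally show 1: "z powr of_real (real n / 2) = csqrt z ^ n" using assms by (simp add: powr_def)
  show "z powr (- of_real (real n / 2)) = 1 / csqrt z ^ n"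
    unfolding powr_minus 1 by (simp add: divide_inverse)
qed

lemma matrix_vector_component:
  fixes M :: "complex^'n^'n"
  shows "(M *v x) $ k = (\<Sum>j\<in>UNIV. M $ k $ j * x $ j)"
  by (simp add: matrix_vector_mult_def)

lemma mat_mult_vector: "(mat p ** M) *v x = p *s (M *v x)" for M :: "complex^'n^'n"
proof -
  have "(mat p ** M) *v x = mat p *v (M *v x)" by (simp add: matrix_vector_mul_assoc)
  also have "\<dots> = p *s (M *v x)"
    by (simp add: vec_eq_iff matrix_vector_mult_def mat_def if_distrib[of "\<lambda>x. x * _"] cong: if_cong)
  finally show ?thesis .
qed

lemma matrix_inv_left:
  fixes M :: "complex^'n^'n"
  assumes "invertible M"
  shows "matrix_inv M ** M = mat 1"
  using someI_ex[OF assms[unfolded invertible_def]] unfolding matrix_inv_def by blast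

lemma SL2Z_det: "\<gamma> \<in> SL2Z \<Longrightarrow> \<gamma>$1$1 * \<gamma>$2$2 - \<gamma>$1$2 * \<gamma>$2$1 = 1"
  by (simp add: SL2Z_def det_2)

definition translation :: "int \<Rightarrow> int^2^2"
  where "translation m = vector [vector [1, m], vector [0, 1]]"

lemma translation_SL2Z: "translation m \<in> SL2Z"
  by (simp add: SL2Z_def translation_def det_2)

lemma translation_mult: "translation m ** translation n = translation (m + n)"
  by (simp add: translation_def vec_eq_iff forall_2 matrix_matrix_mult_def sum_2)

lemma aut_factor_translation: "aut_factor \<kappa> \<rho> \<tau> (translation m) = \<rho> (translation m)"
  by (simp add: aut_factor_def cocycle_denom_def translation_def)

text \<open>
On translations the automorphy factor is 1, so \<open>\<rho>\<close> is multiplicative there and is determined by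
its value at \<open>T\<close>.
\<close>
lemma multiplier_translation:
  fixes \<rho> :: "int^2^2 \<Rightarrow> complex^'r^'r"
  assumes mult: "multiplier_system \<kappa> \<rho>"
    and T: "\<rho> T_mat = (\<chi> i j. if i = j then exp (2 * of_real pi * \<i> * of_real (\<alpha> i)) else 0)"
  shows "\<rho> (translation m) = (\<chi> i j. if i = j then exp (2 * of_real pi * \<i> * of_real (\<alpha> i) * of_int m) else 0)"
proof -
  define D where "D = (\<lambda>m::int. (\<chi> i j. if i = j then exp (2 * of_real pi * \<i> * of_real (\<alpha> i) * of_int m) else 0) :: complex^'r^'r)"
  have D_add: "D m ** D n = D (m + n)" for m n
    by (simp add: D_def vec_eq_iff matrix_matrix_mult_def if_distrib[of "\<lambda>x. x * _"] distrib_left exp_add cong: if_cong)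
  have D0: "D 0 = mat 1" by (simp add: D_def mat_def vec_eq_iff)
  have hom: "\<rho> (translation (m + n)) = \<rho> (translation m) ** \<rho> (translation n)" for m n
  proof -
    have "\<i> \<in> upper_half_plane" by (simp add: upper_half_plane_def)
    with mult translation_SL2Z[of m] translation_SL2Z[of n]
    have "aut_factor \<kappa> \<rho> \<i> (translation m ** translation n) =
       aut_factor \<kappa> \<rho> (SL2Z_act (translation n) \<i>) (translation m) ** aut_factor \<kappa> \<rho> \<i> (translation n)"
      unfolding multiplier_system_def by blast
    then show ?thesis by (simp only: translation_mult aut_factor_translation)
  qed
  have inv: "invertible (\<rho> (translation m))" for m
    using mult translation_SL2Z[of m] unfolding multiplier_system_def by blast
  have one: "\<rho> (translation 1) = D 1"
    using T unfolding T_mat_def translation_def D_def of_int_1 mult_1_right .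
  have "\<rho> (translation m) = D m"
  proof (induction m rule: int_induct[where k = 0])
    case base
    have "\<rho> (translation 0) = (matrix_inv (\<rho> (translation 0)) ** \<rho> (translation 0)) ** \<rho> (translation 0)"
      unfolding matrix_inv_left[OF inv] by simp
    also have "\<dots> = matrix_inv (\<rho> (translation 0)) ** \<rho> (translation (0 + 0))"
      unfolding hom by (simp only: matrix_mul_assoc)
    also have "\<dots> = mat 1" using matrix_inv_left[OF inv] by simp
    finally show ?case by (simp only: D0)
  next
    case (step1 i)
    show ?case unfolding hom step1 one D_add ..
  next
    case (step2 i)
    have "\<rho> (translation (i - 1)) = (\<rho> (translation (i - 1)) ** D 1) ** D (-1)"
      by (simp add: D_add D0 flip: matrix_mul_assoc)
    also have "\<rho> (translation (i - 1)) ** D 1 = D i"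
      unfolding one[symmetric] hom[symmetric] using step2 by simp
    finally show ?case by (simp add: D_add)
  qed
  then show ?thesis by (simp add: D_def)
qed

section \<open>Quantum modularity of the Eichler integral\<close>

theorem mainTheorem5:
  fixes \<kappa> :: real
    and \<rho> :: "int^2^2 \<Rightarrow> complex^'r^'r"
    and \<alpha> :: "'r \<Rightarrow> real"
    and g :: "complex \<Rightarrow> complex^'r"
    and a :: "'r \<Rightarrow> real \<Rightarrow> complex"
  assumes "\<kappa> \<in> {1/2, 3/2}"
    and "multiplier_system \<kappa> \<rho>"
    and "\<forall>\<gamma>\<in>SL2Z. unitary_matrix (\<rho> \<gamma>)"
    and "\<forall>k. \<alpha> k \<in> \<rat> \<inter> {0..<1}"
    and "\<rho> T_mat = (\<chi> i j. if i = j then exp (2 * of_real pi * \<i> * of_real (\<alpha> i)) else 0)"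
    and "\<exists>N>0. (((**) (\<rho> T_mat)) ^^ N) (mat 1) = mat 1"
    and "cusp_form \<kappa> \<rho> \<alpha> g"
    and "cusp_expansion \<kappa> \<alpha> g a"
  shows "holomorphic_quantum_modular_form (2 - \<kappa>) \<rho> (eichler_integral \<kappa> \<alpha> a)"
proof -
  define N :: nat where "N = (if \<kappa> = 1/2 then 3 else 1)"
  have N: "N = 1 \<or> N = 3" by (simp add: N_def)
  have weights: "1 - \<kappa> = real N / 2 - 1" "\<kappa> = real (4 - N) / 2" "2 - \<kappa> = real N / 2"
    using assms(1) by (auto simp: N_def)
  let ?A = "\<lambda>k. expansion_coeffs (\<alpha> k) (a k)"
  let ?f = "eichler_integral \<kappa> \<alpha> a"
  have \<alpha>: "\<alpha> k \<ge> 0" for k using assms(4) by auto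
  have expansion: "((\<lambda>l. a k l * q_power \<tau> l) has_sum (g \<tau> $ k)) (q_exponents (\<alpha> k))" if "Im \<tau> > 0" for k \<tau>
    using assms(8) that unfolding cusp_expansion_def upper_half_plane_def by blast
  have coeffs: "cuspidal_coeffs (\<alpha> k) (?A k)" for k
    by (rule expansion_coeffs_cuspidal(1)[OF \<alpha> expansion])
  have g_eq: "g \<tau> $ k = q_series (\<alpha> k) (?A k) \<tau>" if "Im \<tau> > 0" for k \<tau>
    by (rule expansion_coeffs_cuspidal(2)[OF \<alpha> expansion that])
  have f_eq: "?f \<tau> $ k = q_series (\<alpha> k) (\<lambda>n. of_real ((\<alpha> k + real n) powr (real N / 2 - 1)) * ?A k n) \<tau>"
    if "Im \<tau> > 0" for k \<tau>
    by (rule eichler_integral_q_series[where \<alpha> = \<alpha> and a = a and k = k, OF coeffs N weights(1) that])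
  have hol: "vec_holomorphic_on ?f upper_half_plane"
    unfolding vec_holomorphic_on_def upper_half_plane_def
  proof
    fix k
    show "(\<lambda>\<tau>. ?f \<tau> $ k) holomorphic_on {\<tau>. Im \<tau> > 0}"
      using q_series_holomorphic[OF cuspidal_coeffs_eichler[OF coeffs[of k] N]]
      by (rule holomorphic_transform) (simp add: f_eq)
  qed
  have ext: "extends_holomorphically (modularity_defect (2 - \<kappa>) \<rho> ?f \<gamma>) (cut_plane \<gamma>)" if \<gamma>: "\<gamma> \<in> SL2Z" for \<gamma>
  proof -
    define a' b c d where abcd: "a' = \<gamma>$1$1" "b = \<gamma>$1$2" "c = \<gamma>$2$1" "d = \<gamma>$2$2"
    have det: "a' * d - b * c = 1" using SL2Z_det[OF \<gamma>] by (simp only: abcd)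
    have inv: "invertible (\<rho> \<gamma>)" using assms(2) \<gamma> unfolding multiplier_system_def by blast
    have denom: "cocycle_denom \<gamma> \<tau> = of_int c * \<tau> + of_int d" for \<tau> by (simp add: cocycle_denom_def abcd)
    have act: "SL2Z_act \<gamma> = moebius (of_int a') (of_int b) (of_int c) (of_int d)" by (simp add: SL2Z_act_def abcd)
    show ?thesis
    proof (cases "c = 0")
      case False
      have law: "q_series (\<alpha> k) (?A k) (moebius (of_int a') (of_int b) (of_int c) (of_int d) w)
          = csqrt (of_int c * w + of_int d) ^ (4 - N) * (\<Sum>j\<in>UNIV. \<rho> \<gamma> $ k $ j * q_series (\<alpha> j) (?A j) w)"
        if w: "Im w > 0" for w k
      proof -
        have "of_int c * w + of_int d \<noteq> 0" using csqrt_affine_nonzero[OF False w, of d] by auto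
        note p = powr_half_csqrt(1)[OF this, of "4 - N", folded weights(2)]
        have "real_of_int a' * real_of_int d - real_of_int b * real_of_int c = 1"
          using det by (metis of_int_1 of_int_diff of_int_mult)
        then have im: "Im (SL2Z_act \<gamma> w) > 0"
          unfolding act using w Im_moebius[of a' b c d w] \<open>of_int c * w + of_int d \<noteq> 0\<close> by simp
        have "g (SL2Z_act \<gamma> w) = aut_factor \<kappa> \<rho> w \<gamma> *v g w"
          using assms(7) \<gamma> w unfolding cusp_form_def upper_half_plane_def by blast
        then have "g (SL2Z_act \<gamma> w) $ k = csqrt (of_int c * w + of_int d) ^ (4 - N) * (\<Sum>j\<in>UNIV. \<rho> \<gamma> $ k $ j * g w $ j)"
          unfolding aut_factor_def denom p mat_mult_vector by (simp add: matrix_vector_component)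
        then show ?thesis unfolding g_eq[OF im] g_eq[OF w] unfolding act .
      qed
      have inverse: "(\<Sum>j\<in>UNIV. matrix_inv (\<rho> \<gamma>) $ k $ j * \<rho> \<gamma> $ j $ i) = (if i = k then 1 else 0)" for k i
      proof -
        have "(matrix_inv (\<rho> \<gamma>) ** \<rho> \<gamma>) $ k $ i = mat 1 $ k $ i" unfolding matrix_inv_left[OF inv] ..
        then show ?thesis by (auto simp: matrix_matrix_mult_def mat_def)
      qed
      interpret cuspidal_vector N \<alpha> ?A a' b c d "\<lambda>k j. \<rho> \<gamma> $ k $ j" "\<lambda>k j. matrix_inv (\<rho> \<gamma>) $ k $ j"
        "\<lambda>w. csqrt (of_int c * w + of_int d)" "moebius (of_int a') (of_int b) (of_int c) (of_int d)"
        "\<lambda>k. q_series (\<alpha> k) (?A k)" "\<lambda>k. q_series (\<alpha> k) (\<lambda>n. of_real ((\<alpha> k + real n) powr (real N / 2 - 1)) * ?A k n)"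
        by unfold_locales (use N coeffs det False inverse law in auto)
      have "\<forall>k. \<exists>F. F holomorphic_on cut_plane \<gamma> \<and> (\<forall>\<tau>. Im \<tau> > 0 \<longrightarrow> F \<tau> = modularity_defect (2 - \<kappa>) \<rho> ?f \<gamma> \<tau> $ k)"
      proof
        fix k
        obtain F where F: "F holomorphic_on {\<tau>. of_int c * \<tau> + of_int d \<notin> \<real>\<^sub>\<le>\<^sub>0}"
          "\<And>\<tau>. Im \<tau> > 0 \<Longrightarrow> F \<tau> = (\<Sum>j\<in>UNIV. matrix_inv (\<rho> \<gamma>) $ k $ j *
             q_series (\<alpha> j) (\<lambda>n. of_real ((\<alpha> j + real n) powr (real N / 2 - 1)) * ?A j n) (SL2Z_act \<gamma> \<tau>))
             / csqrt (of_int c * \<tau> + of_int d) ^ N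
             - q_series (\<alpha> k) (\<lambda>n. of_real ((\<alpha> k + real n) powr (real N / 2 - 1)) * ?A k n) \<tau>"
          using defect_extends[of k] unfolding act by blast
        have "F \<tau> = modularity_defect (2 - \<kappa>) \<rho> ?f \<gamma> \<tau> $ k" if \<tau>: "Im \<tau> > 0" for \<tau>
        proof -
          have im: "Im (SL2Z_act \<gamma> \<tau>) > 0" unfolding act by (rule Im_action[OF \<tau>])
          have "of_int c * \<tau> + of_int d \<noteq> 0" using csqrt_affine_nonzero[OF False \<tau>, of d] by auto
          note p = powr_half_csqrt(2)[OF this, of N, folded weights(3)]
          show ?thesis
            unfolding F(2)[OF \<tau>] modularity_defect_def denom p vector_minus_component vector_smult_component
              matrix_vector_component f_eq[OF im] f_eq[OF \<tau>] by simp
        qed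
        moreover have "cut_plane \<gamma> = {\<tau>. of_int c * \<tau> + of_int d \<notin> \<real>\<^sub>\<le>\<^sub>0}"
          by (simp add: cut_plane_def denom)
        ultimately show "\<exists>F. F holomorphic_on cut_plane \<gamma> \<and> (\<forall>\<tau>. Im \<tau> > 0 \<longrightarrow> F \<tau> = modularity_defect (2 - \<kappa>) \<rho> ?f \<gamma> \<tau> $ k)"
          using F(1) by auto
      qed
      from choice[OF this] obtain F where F: "\<And>k. F k holomorphic_on cut_plane \<gamma>"
        "\<And>k \<tau>. Im \<tau> > 0 \<Longrightarrow> F k \<tau> = modularity_defect (2 - \<kappa>) \<rho> ?f \<gamma> \<tau> $ k" by blast
      have "vec_holomorphic_on (\<lambda>\<tau>. \<chi> k. F k \<tau>) (cut_plane \<gamma>)"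
        unfolding vec_holomorphic_on_def using F(1) by simp
      moreover have "\<forall>\<tau>\<in>upper_half_plane. (\<chi> k. F k \<tau>) = modularity_defect (2 - \<kappa>) \<rho> ?f \<gamma> \<tau>"
        by (simp add: vec_eq_iff F(2) upper_half_plane_def)
      ultimately show ?thesis unfolding extends_holomorphically_def by blast
    next
      \<comment> \<open>Here c = 0: for d = 1 the defect vanishes identically by periodicity, and for d = -1 the cut plane is empty.\<close>
      case True
      then have ad: "a' * d = 1" using det by simp
      then consider "d = 1" "a' = 1" | "d = -1" using zmult_eq_1_iff by blast
      then show ?thesis
      proof cases
        case 1
        have \<gamma>_eq: "\<gamma> = translation b"
          using True 1 by (simp add: translation_def vec_eq_iff forall_2 abcd)
        have "modularity_defect (2 - \<kappa>) \<rho> ?f \<gamma> \<tau> = 0" if \<tau>: "Im \<tau> > 0" for \<tau>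
        proof -
          have act_eq: "SL2Z_act \<gamma> \<tau> = \<tau> + of_int b" unfolding act True 1 by (simp add: moebius_def)
          have im: "Im (\<tau> + of_int b) > 0" using \<tau> by simp
          have "?f (\<tau> + of_int b) $ k = (\<rho> \<gamma> *v ?f \<tau>) $ k" for k
          proof -
            have "(\<rho> \<gamma> *v ?f \<tau>) $ k = (\<Sum>j\<in>UNIV. if j = k then exp (2 * of_real pi * \<i> * of_real (\<alpha> k) * of_int b) * ?f \<tau> $ j else 0)"
              unfolding \<gamma>_eq multiplier_translation[OF assms(2,5)] matrix_vector_component by (intro sum.cong) auto
            then show ?thesis
              unfolding f_eq[OF im] q_series_translate[OF cuspidal_coeffs_eichler[OF coeffs N] \<tau>]
              by (simp add: f_eq[OF \<tau>])
          qed
          then have "?f (SL2Z_act \<gamma> \<tau>) = \<rho> \<gamma> *v ?f \<tau>" unfolding act_eq by (simp add: vec_eq_iff)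
          then have "matrix_inv (\<rho> \<gamma>) *v ?f (SL2Z_act \<gamma> \<tau>) = ?f \<tau>"
            by (simp add: matrix_vector_mul_assoc matrix_inv_left[OF inv])
          then show ?thesis unfolding modularity_defect_def denom True 1 by simp
        qed
        then show ?thesis unfolding extends_holomorphically_def vec_holomorphic_on_def upper_half_plane_def
          by (intro exI[of _ "\<lambda>_. 0"]) auto
      next
        case 2
        have "cut_plane \<gamma> = {}" unfolding cut_plane_def denom True 2 by simp
        then show ?thesis unfolding extends_holomorphically_def vec_holomorphic_on_def
          by (intro exI[of _ "modularity_defect (2 - \<kappa>) \<rho> ?f \<gamma>"]) (simp add: holomorphic_on_def)
      qed
    qed
  qed
  show ?thesis unfolding holomorphic_quantum_modular_form_def using hol ext by blast
qed

end
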